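(* Let $W$ be a standard one-dimensional Brownian motion and, for $u\in[0,1]$, let $$Z_u := \int_0^{3u/7} \bigl( \mathbf{1}_{\{W(s)\geq 0\}}\, \vec{e}_1 + \mathbf{1}_{\{W(s)< 0\}}\, \vec{e}_2 \bigr)\,\mathrm{d} s .$$ For $u\in(0,1]$ let $\alpha_u\in[0,\pi/2]$ be the angle between $Z_u$ and $\vec e_1$. Then for all $u\in(0,1]$ and $x\in[0,\pi/2)$, $$P(\alpha_u\le x)=\frac2\pi\arctan\sqrt{\tan x}.$$
   Context: $\vec e_1=(1,0)$, $\vec e_2=(0,1)$. *)

theory Defs
  imports "HOL-Probability.Probability"
begin

text \<open>The index set of the process is \<open>[0, \<infinity>)\<close>; values at negative times are unconstrained.
  Every path is required to be continuous, not just almost every one, so that functionals of the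
  path such as occupation times are measurable without completing \<open>M\<close>.\<close>

locale standard_brownian_motion = prob_space M
  for M :: "'a measure" and W :: "real \<Rightarrow> 'a \<Rightarrow> real" +
  assumes random_variable_W: "\<And>t. 0 \<le> t \<Longrightarrow> random_variable borel (W t)"
    and start_zero: "AE \<omega> in M. W 0 \<omega> = 0"
    and continuous_paths: "\<And>\<omega>. \<omega> \<in> space M \<Longrightarrow> continuous_on {0..} (\<lambda>t. W t \<omega>)"
    and indep_increments: "\<And>(n::nat) (t :: nat \<Rightarrow> real). 0 \<le> t 0 \<Longrightarrow> (\<And>i. i < n \<Longrightarrow> t i < t (Suc i))
      \<Longrightarrow> indep_vars (\<lambda>_. borel) (\<lambda>i \<omega>. W (t (Suc i)) \<omega> - W (t i) \<omega>) {..<n}"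
    and normal_increments: "\<And>s t. 0 \<le> s \<Longrightarrow> s < t
      \<Longrightarrow> distributed M lborel (\<lambda>\<omega>. W t \<omega> - W s \<omega>) (normal_density 0 (sqrt (t - s)))"

definition e1 :: "real ^ 2" where "e1 = axis 1 1"

definition e2 :: "real ^ 2" where "e2 = axis 2 1"

definition Z :: "(real \<Rightarrow> 'a \<Rightarrow> real) \<Rightarrow> real \<Rightarrow> 'a \<Rightarrow> real ^ 2" where
  "Z W u \<omega> = (LINT s:{0..3 * u / 7}|lborel.
     indicator {0..} (W s \<omega>) *\<^sub>R e1 + indicator {..<0} (W s \<omega>) *\<^sub>R e2)"

text \<open>Euclidean angle in \<open>[0, \<pi>]\<close>, with the convention that it is \<open>\<pi>/2\<close> if one of the vectors
  is \<open>0\<close>. Both coordinates of \<open>Z W u \<omega>\<close> are nonnegative, so its angle with \<open>e1\<close> lies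
  in \<open>[0, \<pi>/2]\<close>.\<close>

definition angle :: "'v::real_inner \<Rightarrow> 'v \<Rightarrow> real" where
  "angle x y = arccos (inner x y / (norm x * norm y))"

end

theory Submission
  imports Defs
begin

text \<open>
  With \<open>T = 3 * u / 7\<close> and \<open>A\<close> the time in \<open>[0, T]\<close> that \<open>W\<close> spends in \<open>[0, \<infinity>)\<close>, the vector \<open>Z\<^sub>u\<close> is
  \<open>A e\<^sub>1 + (T - A) e\<^sub>2\<close>, so \<open>\<alpha>\<^sub>u \<le> x\<close> says exactly that \<open>A / T \<ge> 1 / (1 + tan x)\<close>
  (\<open>angle_e1_le_iff\<close>). The claim is therefore Levy's arcsine law for the occupation time
  (\<open>levy_arcsine_law\<close>): \<open>A / T\<close> is distributed like \<open>cos\<^sup>2 \<theta>\<close> with \<open>\<theta>\<close> uniform on \<open>[0, \<pi>/2]\<close>.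

  The arcsine law is derived from its discrete counterpart. The values of \<open>W\<close> on the grid
  \<open>k T / n\<close> form a random walk with independent symmetric Gaussian steps. Let \<open>N\<^sub>n\<close> be the number
  of positive values among the first \<open>n\<close>. Since almost every path has a Lebesgue-null zero set, the
  Riemann sums \<open>N\<^sub>n / n\<close> converge almost surely to \<open>A / T\<close>
  (\<open>grid_count_tendsto_occupation\<close>).

  The law of \<open>N\<^sub>n\<close> is explicit. By the Sparre Andersen principle (\<open>sparre_andersen\<close>) \<open>N\<^sub>n\<close> has the law
  of the first index \<open>L\<^sub>n\<close> at which the walk attains its maximum. The event \<open>L\<^sub>n = k\<close> factors into
  independent events about the first \<open>k\<close> and the last \<open>n - k\<close> steps, and symmetry makes the two
  factors instances \<open>p\<^sub>k\<close>, \<open>p\<^sub>n\<^sub>-\<^sub>k\<close> of one sequence. Total probability makes \<open>p\<close> a convolution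
  square root of \<open>1, 1, 1, \<dots>\<close>, which determines it (\<open>prob_pos_prefixes\<close>).

  Moreover \<open>p\<^sub>k p\<^sub>n\<^sub>-\<^sub>k\<close> is the mean of the Bernstein polynomial \<open>B\<^sub>n\<^sub>,\<^sub>k\<close> at \<open>cos\<^sup>2 \<theta>\<close>: the law of \<open>N\<^sub>n\<close> is a
  binomial law with arcsine distributed success probability. Hence the mean of \<open>f (N\<^sub>n / n)\<close> is
  that of the Bernstein approximation of \<open>f\<close> at \<open>cos\<^sup>2 \<theta>\<close>, which tends to the mean of
  \<open>f (cos\<^sup>2 \<theta>)\<close> for every continuous \<open>f\<close>.
\<close>

section \<open>Prefix sums of finite walks\<close>

text \<open>A list holds the steps of a walk started at \<open>0\<close>. Prefix sums include the empty one, so the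
  maximum is nonnegative, and \<open>argmax_prefix\<close> is the first index at which it is attained.\<close>

primrec max_prefix :: "real list \<Rightarrow> real" where
  "max_prefix [] = 0"
| "max_prefix (x # xs) = max 0 (x + max_prefix xs)"

primrec argmax_prefix :: "real list \<Rightarrow> nat" where
  "argmax_prefix [] = 0"
| "argmax_prefix (x # xs) = (if x + max_prefix xs > 0 then Suc (argmax_prefix xs) else 0)"

definition pos_prefixes :: "real list \<Rightarrow> nat" where
  "pos_prefixes xs = (\<Sum>k = 1..length xs. if sum_list (take k xs) > 0 then 1 else 0)"

lemma max_prefix_nonneg: "0 \<le> max_prefix xs"
  by (cases xs) auto

lemma max_prefix_append: "max_prefix (xs @ ys) = max (max_prefix xs) (sum_list xs + max_prefix ys)"
  by (induction xs) (use max_prefix_nonneg in \<open>auto simp: max_def algebra_simps\<close>)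

lemma sum_list_le_max_prefix: "sum_list xs \<le> max_prefix xs"
  by (induction xs) auto

lemma argmax_prefix_le_length: "argmax_prefix xs \<le> length xs"
  by (induction xs) auto

lemma argmax_prefix_append:
  "argmax_prefix (xs @ ys) =
    (if sum_list xs + max_prefix ys > max_prefix xs then length xs + argmax_prefix ys
     else argmax_prefix xs)"
proof (induction xs)
  case Nil
  have "argmax_prefix ys = 0" if "\<not> max_prefix ys > 0"
    using that by (cases ys) auto
  then show ?case by auto
next
  case (Cons x xs)
  then show ?case
    by (auto simp: max_prefix_append)
qed

text \<open>This and the next lemma carry the Sparre Andersen principle: the end point of a walk that finishes
  at or below \<open>0\<close> is never the first maximum, while the start of a walk that finishes above \<open>0\<close>
  is never a maximum.\<close>

lemma argmax_prefix_snoc_nonpos: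
  assumes "sum_list (xs @ [y]) \<le> 0"
  shows "argmax_prefix (xs @ [y]) = argmax_prefix xs"
  using assms max_prefix_nonneg[of xs] sum_list_le_max_prefix[of xs]
  by (auto simp: argmax_prefix_append)

lemma argmax_prefix_Cons_pos:
  assumes "0 < sum_list (x # xs)"
  shows "argmax_prefix (x # xs) = Suc (argmax_prefix xs)"
  using assms sum_list_le_max_prefix[of xs] by simp

text \<open>Looking back and ahead from the splitting point, the maximum is first attained there iff it is a
  strict record for the first part and never exceeded in the second. These two conditions involve
  disjoint sets of steps, which makes the law of the index of the maximum factor.\<close>

lemma argmax_prefix_append_eq_length_iff:
  "argmax_prefix (xs @ ys) = length xs \<longleftrightarrow>
    argmax_prefix xs = length xs \<and> argmax_prefix ys = 0"
proof -
  have full: "max_prefix zs = sum_list zs" if "argmax_prefix zs = length zs" for zs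
    using that by (induction zs) (auto split: if_splits)
  have zero: "argmax_prefix zs = 0 \<longleftrightarrow> max_prefix zs = 0" for zs
    by (cases zs) auto
  show ?thesis
    using full[of xs] zero[of ys] sum_list_le_max_prefix[of xs] max_prefix_nonneg[of ys]
    by (auto simp: argmax_prefix_append)
qed

lemma pos_prefixes_snoc:
  "pos_prefixes (xs @ [x]) = (if sum_list xs + x > 0 then Suc (pos_prefixes xs) else pos_prefixes xs)"
proof -
  have "(\<Sum>k = 1..length xs. if sum_list (take k (xs @ [x])) > 0 then 1 else 0) = pos_prefixes xs"
    unfolding pos_prefixes_def by (intro sum.cong) auto
  then show ?thesis by (simp add: pos_prefixes_def)
qed

lemma pos_prefixes_uminus:
  assumes "\<And>k. k \<in> {1..length xs} \<Longrightarrow> sum_list (take k xs) \<noteq> 0"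
  shows "pos_prefixes xs + pos_prefixes (map uminus xs) = length xs"
proof -
  have *: "sum_list (take k (map uminus xs)) = - sum_list (take k xs)" for k
    by (simp add: take_map uminus_sum_list_map comp_def flip: uminus_sum_list_map[of id, simplified])
  have "pos_prefixes xs + pos_prefixes (map uminus xs) = (\<Sum>k = 1..length xs. 1)"
    unfolding pos_prefixes_def * length_map sum.distrib[symmetric]
    using assms by (intro sum.cong) (auto simp: not_less_iff_gr_or_eq)
  then show ?thesis by simp
qed

lemma measurable_sum_list_map [measurable (raw)]:
  fixes Y :: "'i \<Rightarrow> 'k \<Rightarrow> real"
  assumes "\<And>i. i \<in> set is \<Longrightarrow> Y i \<in> borel_measurable K"
  shows "(\<lambda>\<omega>. sum_list (map (\<lambda>i. Y i \<omega>) is)) \<in> borel_measurable K"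
  using assms by (induction "is") auto

lemma measurable_max_prefix [measurable (raw)]:
  assumes "\<And>i. i \<in> set is \<Longrightarrow> Y i \<in> borel_measurable K"
  shows "(\<lambda>\<omega>. max_prefix (map (\<lambda>i. Y i \<omega>) is)) \<in> borel_measurable K"
  using assms by (induction "is") auto

lemma measurable_argmax_prefix [measurable (raw)]:
  assumes "\<And>i. i \<in> set is \<Longrightarrow> Y i \<in> borel_measurable K"
  shows "(\<lambda>\<omega>. argmax_prefix (map (\<lambda>i. Y i \<omega>) is)) \<in> measurable K (count_space UNIV)"
  using assms
proof (induction "is")
  case (Cons i "is")
  have [measurable]: "Y i \<in> borel_measurable K" "(\<lambda>\<omega>. max_prefix (map (\<lambda>i. Y i \<omega>) is)) \<in> borel_measurable K"
    "(\<lambda>\<omega>. argmax_prefix (map (\<lambda>i. Y i \<omega>) is)) \<in> measurable K (count_space UNIV)"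
    using Cons by (auto intro!: measurable_max_prefix)
  show ?case by simp
qed simp

lemma measurable_pos_prefixes [measurable (raw)]:
  assumes "\<And>i. i \<in> set is \<Longrightarrow> Y i \<in> borel_measurable K"
  shows "(\<lambda>\<omega>. pos_prefixes (map (\<lambda>i. Y i \<omega>) is)) \<in> measurable K (count_space UNIV)"
  using assms
proof (induction "is" rule: rev_induct)
  case (snoc i "is")
  have [measurable]: "Y i \<in> borel_measurable K" "(\<lambda>\<omega>. sum_list (map (\<lambda>i. Y i \<omega>) is)) \<in> borel_measurable K"
    "(\<lambda>\<omega>. pos_prefixes (map (\<lambda>i. Y i \<omega>) is)) \<in> measurable K (count_space UNIV)"
    using snoc by (auto intro!: measurable_sum_list_map)
  show ?case by (simp add: pos_prefixes_snoc)
qed (simp add: pos_prefixes_def)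

section \<open>The Sparre Andersen principle\<close>

abbreviation walk_space :: "(real \<times> nat) measure" where
  "walk_space \<equiv> borel \<Otimes>\<^sub>M count_space UNIV"

text \<open>One step of the Markov chain (current position, number of positive positions so far).\<close>

definition walk_step :: "(real \<times> nat) \<times> real \<Rightarrow> real \<times> nat" where
  "walk_step = (\<lambda>((s, k), x). (s + x, if s + x > 0 then Suc k else k))"

lemma measurable_walk_step [measurable]: "walk_step \<in> measurable (walk_space \<Otimes>\<^sub>M borel) walk_space"
  unfolding walk_step_def split_beta by measurable

context prob_space
begin

definition iid :: "real measure \<Rightarrow> ('i \<Rightarrow> 'a \<Rightarrow> real) \<Rightarrow> 'i set \<Rightarrow> bool" where
  "iid \<mu> X I \<longleftrightarrow> indep_vars (\<lambda>_. borel) X I \<and> (\<forall>i\<in>I. distr M borel (X i) = \<mu>)"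

definition steps :: "('i \<Rightarrow> 'a \<Rightarrow> real) \<Rightarrow> 'i list \<Rightarrow> 'a \<Rightarrow> real list" where
  "steps X is \<omega> = map (\<lambda>i. X i \<omega>) is"

lemma iid_measurable:
  assumes "iid \<mu> X I" "i \<in> I"
  shows "X i \<in> borel_measurable M"
  using assms unfolding iid_def by (auto simp: indep_vars_def2)

lemma measurable_steps_functionals [measurable (raw)]:
  assumes "\<And>i. i \<in> set is \<Longrightarrow> X i \<in> borel_measurable M"
  shows "(\<lambda>\<omega>. sum_list (steps X is \<omega>)) \<in> borel_measurable M"
    "(\<lambda>\<omega>. argmax_prefix (steps X is \<omega>)) \<in> measurable M (count_space UNIV)"
    "(\<lambda>\<omega>. pos_prefixes (steps X is \<omega>)) \<in> measurable M (count_space UNIV)"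
  using assms unfolding steps_def
  by (auto intro: measurable_sum_list_map measurable_argmax_prefix measurable_pos_prefixes)

text \<open>Disjoint sets of steps are independent. This is expressed as a product of laws rather than with
  \<open>indep_var\<close>, whose two random variables must have the same type, while here a functional of the
  walk is paired with a single real step.\<close>

lemma distr_steps_pair:
  assumes "iid \<mu> X I" "set is \<subseteq> I" "set js \<subseteq> I" "set is \<inter> set js = {}"
    and F: "(\<lambda>f. F (map f is)) \<in> measurable (PiM (set is) (\<lambda>_. borel)) K"
    and G: "(\<lambda>f. G (map f js)) \<in> measurable (PiM (set js) (\<lambda>_. borel)) L"
  shows "distr M (K \<Otimes>\<^sub>M L) (\<lambda>\<omega>. (F (steps X is \<omega>), G (steps X js \<omega>))) =
    distr M K (\<lambda>\<omega>. F (steps X is \<omega>)) \<Otimes>\<^sub>M distr M L (\<lambda>\<omega>. G (steps X js \<omega>))"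
proof -
  let ?R = "\<lambda>ks \<omega>. restrict (\<lambda>i. X i \<omega>) (set ks)" and ?P = "\<lambda>ks. PiM (set ks) (\<lambda>_. borel :: real measure)"
  have ind: "indep_var (?P is) (?R is) (?P js) (?R js)"
    using assms by (intro indep_var_restrict) (auto simp: iid_def)
  have [measurable]: "?R is \<in> measurable M (?P is)" "?R js \<in> measurable M (?P js)"
    using ind by (auto simp: indep_var_distribution_eq)
  have joint: "distr M (?P is) (?R is) \<Otimes>\<^sub>M distr M (?P js) (?R js) = distr M (?P is \<Otimes>\<^sub>M ?P js) (\<lambda>\<omega>. (?R is \<omega>, ?R js \<omega>))"
    using ind by (auto simp: indep_var_distribution_eq)
  note [measurable] = F G
  have *: "map (restrict f (set ks)) ks = map f ks" for f :: "'b \<Rightarrow> real" and ks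
    by (intro map_cong) auto
  have 1: "distr M K (\<lambda>\<omega>. F (steps X is \<omega>)) = distr (distr M (?P is) (?R is)) K (\<lambda>f. F (map f is))"
    by (subst distr_distr) (auto simp: comp_def steps_def *)
  have 2: "distr M L (\<lambda>\<omega>. G (steps X js \<omega>)) = distr (distr M (?P js) (?R js)) L (\<lambda>f. G (map f js))"
    by (subst distr_distr) (auto simp: comp_def steps_def *)
  have "prob_space (distr (distr M (?P js) (?R js)) L (\<lambda>f. G (map f js)))"
    by (intro prob_space.prob_space_distr prob_space_distr) auto
  then have "distr (distr M (?P is) (?R is)) K (\<lambda>f. F (map f is)) \<Otimes>\<^sub>M distr (distr M (?P js) (?R js)) L (\<lambda>f. G (map f js))
    = distr (distr M (?P is) (?R is) \<Otimes>\<^sub>M distr M (?P js) (?R js)) (K \<Otimes>\<^sub>M L) (\<lambda>(f, g). (F (map f is), G (map g js)))"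
    by (intro pair_measure_distr) (auto intro: prob_space_imp_sigma_finite)
  also have "\<dots> = distr M (K \<Otimes>\<^sub>M L) (\<lambda>\<omega>. (F (steps X is \<omega>), G (steps X js \<omega>)))"
    unfolding joint by (subst distr_distr) (auto simp: comp_def steps_def *)
  finally show ?thesis by (simp add: 1 2)
qed

lemma distr_steps_last:
  assumes "iid \<mu> X I" "set is \<subseteq> I" "i \<in> I" "i \<notin> set is"
    and F: "(\<lambda>f. F (map f is)) \<in> measurable (PiM (set is) (\<lambda>_. borel)) K"
  shows "distr M (K \<Otimes>\<^sub>M borel) (\<lambda>\<omega>. (F (steps X is \<omega>), X i \<omega>)) = distr M K (\<lambda>\<omega>. F (steps X is \<omega>)) \<Otimes>\<^sub>M \<mu>"
proof -
  have "distr M (K \<Otimes>\<^sub>M borel) (\<lambda>\<omega>. (F (steps X is \<omega>), sum_list (steps X [i] \<omega>))) =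
    distr M K (\<lambda>\<omega>. F (steps X is \<omega>)) \<Otimes>\<^sub>M distr M borel (\<lambda>\<omega>. sum_list (steps X [i] \<omega>))"
    by (rule distr_steps_pair[OF assms(1)]) (use assms in auto)
  moreover have "distr M borel (X i) = \<mu>"
    using assms by (simp add: iid_def)
  ultimately show ?thesis
    by (simp add: steps_def)
qed

lemma measurable_sum_list_argmax:
  "(\<lambda>f. (sum_list (map f is), argmax_prefix (map f is)))
    \<in> measurable (PiM (set is) (\<lambda>_. borel)) walk_space"
  by (intro measurable_Pair measurable_sum_list_map measurable_argmax_prefix) auto

lemma measurable_sum_list_pos:
  "(\<lambda>f. (sum_list (map f is), pos_prefixes (map f is)))
    \<in> measurable (PiM (set is) (\<lambda>_. borel)) walk_space"
  by (intro measurable_Pair measurable_sum_list_map measurable_pos_prefixes) auto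

text \<open>Both sides satisfy the same recursion in the number of steps. Appending a step to a walk
  makes the pair of position and positive count move by \<open>walk_step\<close>. For the index of the maximum, the step to
  split off is chosen according to the sign of the final position: the last step if it is nonpositive
  (the index is unchanged), the first step otherwise (the index grows by one). In both cases the
  remaining walk is independent of the removed step, and carrying the position along in the pair
  keeps the sign condition expressible. The step sequence and index list may differ on the two sides;
  this covers shifts of the index range and reflection of the walk.\<close>

theorem sparre_andersen:
  assumes "iid \<mu> X I" "iid \<mu> Y J" "set is \<subseteq> I" "set js \<subseteq> J" "distinct is" "distinct js"
    "length is = length js"
  shows "distr M walk_space (\<lambda>\<omega>. (sum_list (steps X is \<omega>), argmax_prefix (steps X is \<omega>))) =
    distr M walk_space (\<lambda>\<omega>. (sum_list (steps Y js \<omega>), pos_prefixes (steps Y js \<omega>)))"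
  using assms(3-)
proof (induction "length is" arbitrary: "is" js)
  case 0
  then show ?case by (simp add: steps_def pos_prefixes_def)
next
  case (Suc n)
  let ?L = "\<lambda>is \<omega>. (sum_list (steps X is \<omega>), argmax_prefix (steps X is \<omega>))"
  let ?N = "\<lambda>js \<omega>. (sum_list (steps Y js \<omega>), pos_prefixes (steps Y js \<omega>))"
  obtain a as where as: "is = a # as" using Suc by (cases "is") auto
  obtain b bs where bs: "is = bs @ [b]" using Suc by (cases "is" rule: rev_cases) auto
  obtain c cs where cs: "js = cs @ [c]" using Suc by (cases js rule: rev_cases) auto
  have len: "length as = n" "length bs = n" "length cs = n"
    using Suc.hyps(2) Suc.prems(5) arg_cong[OF as, of length] arg_cong[OF bs, of length]
      arg_cong[OF cs, of length] by auto
  have sub: "set as \<subseteq> I" "a \<in> I" "set bs \<subseteq> I" "b \<in> I" "set cs \<subseteq> J" "c \<in> J"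
    "a \<notin> set as" "b \<notin> set bs" "c \<notin> set cs" "distinct as" "distinct bs" "distinct cs"
    using Suc.prems[unfolded as] Suc.prems[unfolded bs] Suc.prems[unfolded cs] by auto
  have [measurable]: "i \<in> I \<Longrightarrow> X i \<in> borel_measurable M" "j \<in> J \<Longrightarrow> Y j \<in> borel_measurable M" for i j
    using iid_measurable[OF assms(1)] iid_measurable[OF assms(2)] by auto
  have mL [measurable]: "?L ks \<in> measurable M walk_space" if "set ks \<subseteq> I" for ks
    using that by (intro measurable_Pair measurable_steps_functionals) auto
  have mN [measurable]: "?N ks \<in> measurable M walk_space" if "set ks \<subseteq> J" for ks
    using that by (intro measurable_Pair measurable_steps_functionals) auto
  \<comment> \<open>The joint law of the shortened pair and the removed step is the same for all three decompositions.\<close>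
  define \<rho> where "\<rho> = distr M walk_space (?N cs) \<Otimes>\<^sub>M \<mu>"
  have \<rho>N: "\<rho> = distr M (walk_space \<Otimes>\<^sub>M borel) (\<lambda>\<omega>. (?N cs \<omega>, Y c \<omega>))"
    unfolding \<rho>_def using distr_steps_last[OF assms(2) sub(5,6,9) measurable_sum_list_pos] by simp
  have \<rho>bs: "\<rho> = distr M (walk_space \<Otimes>\<^sub>M borel) (\<lambda>\<omega>. (?L bs \<omega>, X b \<omega>))"
    using distr_steps_last[OF assms(1) sub(3,4,8) measurable_sum_list_argmax] Suc.hyps(1)[of bs cs, OF len(2)[symmetric]] len sub
    by (auto simp: \<rho>_def)
  have \<rho>as: "\<rho> = distr M (walk_space \<Otimes>\<^sub>M borel) (\<lambda>\<omega>. (?L as \<omega>, X a \<omega>))"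
    using distr_steps_last[OF assms(1) sub(1,2,7) measurable_sum_list_argmax] Suc.hyps(1)[of as cs, OF len(1)[symmetric]] len sub
    by (auto simp: \<rho>_def)
  show ?case
  proof (rule measure_eqI)
    fix A assume "A \<in> sets (distr M walk_space (?L is))"
    then have A [measurable]: "A \<in> sets walk_space" by simp
    define B where "B = {p \<in> space (walk_space \<Otimes>\<^sub>M borel). walk_step p \<in> A}"
    define B1 where "B1 = {p \<in> space (walk_space \<Otimes>\<^sub>M borel). walk_step p \<in> A \<and> fst (walk_step p) \<le> 0}"
    define B2 where "B2 = {p \<in> space (walk_space \<Otimes>\<^sub>M borel). walk_step p \<in> A \<and> \<not> fst (walk_step p) \<le> 0}"
    have meas [measurable]: "B \<in> sets (walk_space \<Otimes>\<^sub>M borel)" "B1 \<in> sets (walk_space \<Otimes>\<^sub>M borel)" "B2 \<in> sets (walk_space \<Otimes>\<^sub>M borel)"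
      unfolding B_def B1_def B2_def by measurable
    have Lb: "?L is \<omega> = walk_step (?L bs \<omega>, X b \<omega>)" if "sum_list (steps X is \<omega>) \<le> 0" for \<omega>
      using that argmax_prefix_snoc_nonpos[of "steps X bs \<omega>" "X b \<omega>"]
      by (simp add: bs walk_step_def steps_def)
    have La: "?L is \<omega> = walk_step (?L as \<omega>, X a \<omega>)" if "\<not> sum_list (steps X is \<omega>) \<le> 0" for \<omega>
      using that argmax_prefix_Cons_pos[of "X a \<omega>" "steps X as \<omega>"]
      by (simp add: as walk_step_def steps_def add.commute)
    have sb: "fst (walk_step (?L bs \<omega>, X b \<omega>)) = sum_list (steps X is \<omega>)" for \<omega>
      by (simp add: bs walk_step_def steps_def)
    have sa: "fst (walk_step (?L as \<omega>, X a \<omega>)) = sum_list (steps X is \<omega>)" for \<omega>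
      by (simp add: as walk_step_def steps_def add.commute)
    have N: "?N js \<omega> = walk_step (?N cs \<omega>, Y c \<omega>)" for \<omega>
      using pos_prefixes_snoc[of "steps Y cs \<omega>" "Y c \<omega>"]
      by (simp add: cs walk_step_def steps_def)
    have "emeasure (distr M walk_space (?L is)) A = emeasure M (?L is -` A \<inter> space M)"
      using Suc.prems by (simp add: emeasure_distr)
    also have "?L is -` A \<inter> space M =
        ((\<lambda>\<omega>. (?L bs \<omega>, X b \<omega>)) -` B1 \<inter> space M) \<union> ((\<lambda>\<omega>. (?L as \<omega>, X a \<omega>)) -` B2 \<inter> space M)"
    proof (intro set_eqI)
      fix \<omega>
      show "\<omega> \<in> ?L is -` A \<inter> space M \<longleftrightarrow> \<omega> \<in> ((\<lambda>\<omega>. (?L bs \<omega>, X b \<omega>)) -` B1 \<inter> space M)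
          \<union> ((\<lambda>\<omega>. (?L as \<omega>, X a \<omega>)) -` B2 \<inter> space M)"
        by (cases "sum_list (steps X is \<omega>) \<le> 0")
          (simp_all add: La Lb B1_def B2_def sa sb space_pair_measure)
    qed
    also have "emeasure M \<dots> = emeasure M ((\<lambda>\<omega>. (?L bs \<omega>, X b \<omega>)) -` B1 \<inter> space M)
        + emeasure M ((\<lambda>\<omega>. (?L as \<omega>, X a \<omega>)) -` B2 \<inter> space M)"
      using sub by (intro plus_emeasure[symmetric] measurable_sets[OF _ meas(2)] measurable_sets[OF _ meas(3)] measurable_Pair mL)
        (auto simp: B1_def B2_def sa sb)
    also have "\<dots> = emeasure \<rho> B1 + emeasure \<rho> B2"
    proof -
      have "emeasure \<rho> B1 = emeasure M ((\<lambda>\<omega>. (?L bs \<omega>, X b \<omega>)) -` B1 \<inter> space M)"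
        unfolding \<rho>bs using sub by (intro emeasure_distr measurable_Pair mL meas) auto
      moreover have "emeasure \<rho> B2 = emeasure M ((\<lambda>\<omega>. (?L as \<omega>, X a \<omega>)) -` B2 \<inter> space M)"
        unfolding \<rho>as using sub by (intro emeasure_distr measurable_Pair mL meas) auto
      ultimately show ?thesis by simp
    qed
    also have "\<dots> = emeasure \<rho> (B1 \<union> B2)"
      by (intro plus_emeasure) (auto simp: \<rho>N B1_def B2_def intro: meas)
    also have "B1 \<union> B2 = B"
      by (auto simp: B1_def B2_def B_def)
    also have "emeasure \<rho> B = emeasure M ((\<lambda>\<omega>. (?N cs \<omega>, Y c \<omega>)) -` B \<inter> space M)"
      unfolding \<rho>N using sub by (intro emeasure_distr measurable_Pair mN meas) auto
    also have "(\<lambda>\<omega>. (?N cs \<omega>, Y c \<omega>)) -` B \<inter> space M = ?N js -` A \<inter> space M"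
      by (auto simp: B_def N space_pair_measure)
    also have "emeasure M \<dots> = emeasure (distr M walk_space (?N js)) A"
      using Suc.prems by (simp add: emeasure_distr)
    finally show "emeasure (distr M walk_space (?L is)) A = emeasure (distr M walk_space (?N js)) A" .
  qed simp
qed

end

section \<open>Bernstein polynomials and the arcsine weights\<close>

text \<open>The value at \<open>k\<close> is \<open>(2 * k choose k) / 4 ^ k\<close>.\<close>

primrec arcsine_weight :: "nat \<Rightarrow> real" where
  "arcsine_weight 0 = 1"
| "arcsine_weight (Suc k) = arcsine_weight k * ((2 * real k + 1) / (2 * real k + 2))"

definition trig_moment :: "nat \<Rightarrow> nat \<Rightarrow> real" where
  "trig_moment k m = integral {0..pi/2} (\<lambda>\<theta>. cos \<theta> ^ (2 * k) * sin \<theta> ^ (2 * m))"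

lemma trig_moment_split: "trig_moment k m = trig_moment (Suc k) m + trig_moment k (Suc m)"
proof -
  have "trig_moment (Suc k) m + trig_moment k (Suc m) =
    integral {0..pi/2} (\<lambda>\<theta>. cos \<theta> ^ (2 * Suc k) * sin \<theta> ^ (2 * m) + cos \<theta> ^ (2 * k) * sin \<theta> ^ (2 * Suc m))"
    unfolding trig_moment_def
    by (intro integral_add[symmetric] integrable_continuous_real continuous_intros)
  also have "\<dots> = trig_moment k m"
    unfolding trig_moment_def
  proof (intro integral_cong)
    fix \<theta> :: real
    have "c ^ (2 * Suc k) * s ^ (2 * m) + c ^ (2 * k) * s ^ (2 * Suc m)
      = c ^ (2 * k) * s ^ (2 * m) * (c\<^sup>2 + s\<^sup>2)" for c s :: real
      by (simp add: algebra_simps power2_eq_square)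
    from this[of "cos \<theta>" "sin \<theta>"] show "cos \<theta> ^ (2 * Suc k) * sin \<theta> ^ (2 * m) + cos \<theta> ^ (2 * k) * sin \<theta> ^ (2 * Suc m)
      = cos \<theta> ^ (2 * k) * sin \<theta> ^ (2 * m)" by simp
  qed
  finally show ?thesis ..
qed

text \<open>Integrate the derivative of \<open>cos\<^sup>2\<^sup>k\<^sup>+\<^sup>1 \<theta> sin\<^sup>2\<^sup>m\<^sup>+\<^sup>1 \<theta>\<close>, which vanishes at both end points.\<close>

lemma trig_moment_by_parts:
  "(2 * real k + 1) * trig_moment k (Suc m) = (2 * real m + 1) * trig_moment (Suc k) m"
proof -
  let ?F = "\<lambda>\<theta>::real. cos \<theta> ^ (2 * k + 1) * sin \<theta> ^ (2 * m + 1)"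
  let ?f = "\<lambda>\<theta>::real. (2 * real m + 1) * (cos \<theta> ^ (2 * Suc k) * sin \<theta> ^ (2 * m))
      - (2 * real k + 1) * (cos \<theta> ^ (2 * k) * sin \<theta> ^ (2 * Suc m))"
  have "(?F has_real_derivative ?f \<theta>) (at \<theta>)" for \<theta>
    using DERIV_mult[OF DERIV_power_Suc[OF DERIV_cos[of \<theta>], of "2 * k"] DERIV_power_Suc[OF DERIV_sin[of \<theta>], of "2 * m"]]
    unfolding Suc_eq_plus1 by (rule DERIV_cong) (simp add: algebra_simps)
  then have "(?F has_real_derivative ?f \<theta>) (at \<theta> within {0..pi/2})" for \<theta>
    by (rule has_field_derivative_at_within)
  then have "(?f has_integral ?F (pi/2) - ?F 0) {0..pi/2}"
    by (intro fundamental_theorem_of_calculus)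
      (auto simp: has_real_derivative_iff_has_vector_derivative[symmetric])
  then have "integral {0..pi/2} ?f = 0" by (auto dest!: integral_unique)
  moreover have "integral {0..pi/2} ?f =
      (2 * real m + 1) * trig_moment (Suc k) m - (2 * real k + 1) * trig_moment k (Suc m)"
    unfolding trig_moment_def
    by (subst integral_diff) (auto intro!: integrable_continuous_real continuous_intros)
  ultimately show ?thesis by simp
qed

lemma trig_moment_Suc:
  "2 * (real k + real m + 1) * trig_moment (Suc k) m = (2 * real k + 1) * trig_moment k m"
  "2 * (real k + real m + 1) * trig_moment k (Suc m) = (2 * real m + 1) * trig_moment k m"
  using trig_moment_split[of k m] trig_moment_by_parts[of k m] by (simp_all add: algebra_simps)

lemma binomial_trig_moment:
  "real ((k + m) choose k) * trig_moment k m = pi / 2 * (arcsine_weight k * arcsine_weight m)"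
proof (induction k)
  case 0
  show ?case
  proof (induction m)
    case 0
    show ?case by (simp add: trig_moment_def)
  next
    case (Suc m)
    have "trig_moment 0 (Suc m) = (2 * real m + 1) / (2 * real m + 2) * trig_moment 0 m"
      using trig_moment_Suc(2)[of 0 m] by (simp add: field_simps)
    moreover have "trig_moment 0 m = pi / 2 * arcsine_weight m"
      using Suc by simp
    ultimately show ?case by simp
  qed
next
  case (Suc k)
  have "real (Suc k) * real ((Suc k + m) choose Suc k) = (real k + real m + 1) * real ((k + m) choose k)"
    using arg_cong[OF Suc_times_binomial[of k "k + m"], of real]
    by (simp add: algebra_simps del: binomial_Suc_Suc)
  then have b: "real ((Suc k + m) choose Suc k) = (real k + real m + 1) * real ((k + m) choose k) / real (Suc k)"
    by (simp add: field_simps)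
  have "2 * real (Suc k) * (real ((Suc k + m) choose Suc k) * trig_moment (Suc k) m)
      = real ((k + m) choose k) * (2 * (real k + real m + 1) * trig_moment (Suc k) m)"
    unfolding b by (simp add: divide_simps) (simp add: algebra_simps)
  also have "\<dots> = (2 * real k + 1) * (pi / 2 * (arcsine_weight k * arcsine_weight m))"
    unfolding trig_moment_Suc Suc[symmetric] by simp
  finally show ?case by (simp add: field_simps)
qed

text \<open>Up to the binomial factor, a Bernstein polynomial at \<open>cos\<^sup>2 \<theta>\<close> is the monomial
  \<open>cos\<^sup>2\<^sup>k \<theta> sin\<^sup>2\<^sup>n\<^sup>-\<^sup>2\<^sup>k \<theta>\<close>. The product form of the mean is what links the arcsine law to random walks.\<close>

lemma integral_Bernstein_cos_squared:
  assumes "k \<le> n"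
  shows "2 / pi * integral {0..pi/2} (\<lambda>\<theta>. Bernstein n k ((cos \<theta>)\<^sup>2)) = arcsine_weight k * arcsine_weight (n - k)"
proof -
  have "Bernstein n k ((cos \<theta>)\<^sup>2) = real (n choose k) * (cos \<theta> ^ (2 * k) * sin \<theta> ^ (2 * (n - k)))" for \<theta>
  proof -
    have "1 - (cos \<theta>)\<^sup>2 = (sin \<theta>)\<^sup>2" by (simp add: sin_squared_eq)
    then show ?thesis by (simp add: Bernstein_def power_mult)
  qed
  then have "integral {0..pi/2} (\<lambda>\<theta>. Bernstein n k ((cos \<theta>)\<^sup>2)) = real (n choose k) * trig_moment k (n - k)"
    by (simp add: trig_moment_def)
  also have "\<dots> = pi / 2 * (arcsine_weight k * arcsine_weight (n - k))"
    using binomial_trig_moment[of k "n - k"] assms by simp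
  finally show ?thesis by (simp add: field_simps)
qed

lemma continuous_on_Bernstein [continuous_intros]:
  "continuous_on A f \<Longrightarrow> continuous_on A (\<lambda>x. Bernstein n k (f x))"
  unfolding Bernstein_def by (intro continuous_intros)

text \<open>The Bernstein polynomials of degree \<open>n\<close> sum to \<open>1\<close>, hence so do their means.\<close>

lemma arcsine_weight_convolution: "(\<Sum>k\<le>n. arcsine_weight k * arcsine_weight (n - k)) = 1"
proof -
  have "(\<Sum>k\<le>n. arcsine_weight k * arcsine_weight (n - k)) =
      2 / pi * (\<Sum>k\<le>n. integral {0..pi/2} (\<lambda>\<theta>. Bernstein n k ((cos \<theta>)\<^sup>2)))"
    unfolding sum_distrib_left by (intro sum.cong) (auto simp: integral_Bernstein_cos_squared[symmetric])
  also have "\<dots> = 2 / pi * integral {0..pi/2} (\<lambda>\<theta>. \<Sum>k\<le>n. Bernstein n k ((cos \<theta>)\<^sup>2))"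
    by (subst integral_sum) (auto intro!: integrable_continuous_real continuous_intros)
  also have "\<dots> = 1" by simp
  finally show ?thesis .
qed

text \<open>For \<open>m > 0\<close> and \<open>a 0 = 1\<close> the \<open>m\<close>-th convolution value is \<open>2 * a m\<close> plus terms with smaller
  indices only.\<close>

lemma convolution_square_root_unique:
  fixes a b :: "nat \<Rightarrow> real"
  assumes "a 0 = 1" "b 0 = 1"
    and "\<And>m. m \<le> n \<Longrightarrow> (\<Sum>k\<le>m. a k * a (m - k)) = (\<Sum>k\<le>m. b k * b (m - k))"
  shows "m \<le> n \<Longrightarrow> a m = b m"
proof (induction m rule: less_induct)
  case (less m)
  show ?case
  proof (cases m)
    case (Suc l)
    have split: "(\<Sum>k\<le>m. d k * d (m - k)) = 2 * d m + (\<Sum>k\<in>{1..l}. d k * d (m - k))" if "d 0 = 1" for d :: "nat \<Rightarrow> real"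
    proof -
      have "{..m} = insert 0 (insert m {1..l})" using Suc by auto
      then show ?thesis using that Suc by simp
    qed
    have "(\<Sum>k\<in>{1..l}. a k * a (m - k)) = (\<Sum>k\<in>{1..l}. b k * b (m - k))"
      using less Suc by (intro sum.cong) auto
    then show ?thesis using assms(3)[OF less.prems] split[of a] split[of b] assms(1,2) by simp
  qed (simp add: assms)
qed

section \<open>The discrete arcsine law\<close>

context prob_space
begin

lemma prob_argmax_eq_prob_pos_prefixes:
  assumes "iid \<mu> X I" "iid \<mu> Y J" "set is \<subseteq> I" "set js \<subseteq> J" "distinct is" "distinct js"
    "length is = length js"
  shows "prob {\<omega> \<in> space M. argmax_prefix (steps X is \<omega>) = k} = prob {\<omega> \<in> space M. pos_prefixes (steps Y js \<omega>) = k}"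
proof -
  have [measurable]: "i \<in> set is \<Longrightarrow> X i \<in> borel_measurable M" "j \<in> set js \<Longrightarrow> Y j \<in> borel_measurable M" for i j
    using iid_measurable[OF assms(1)] iid_measurable[OF assms(2)] assms(3,4) by auto
  have "measure (distr M walk_space (\<lambda>\<omega>. (sum_list (steps X is \<omega>), argmax_prefix (steps X is \<omega>)))) (UNIV \<times> {k}) =
    prob {\<omega> \<in> space M. argmax_prefix (steps X is \<omega>) = k}"
    by (subst measure_distr) (auto intro!: arg_cong[where f=prob] measurable_Pair measurable_steps_functionals)
  moreover have "measure (distr M walk_space (\<lambda>\<omega>. (sum_list (steps Y js \<omega>), pos_prefixes (steps Y js \<omega>)))) (UNIV \<times> {k}) =
    prob {\<omega> \<in> space M. pos_prefixes (steps Y js \<omega>) = k}"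
    by (subst measure_distr) (auto intro!: arg_cong[where f=prob] measurable_Pair measurable_steps_functionals)
  ultimately show ?thesis
    using sparre_andersen[OF assms] by simp
qed

lemma prob_argmax_append:
  assumes "iid \<mu> X I" "set is \<subseteq> I" "set js \<subseteq> I" "set is \<inter> set js = {}"
  shows "prob {\<omega> \<in> space M. argmax_prefix (steps X (is @ js) \<omega>) = length is} =
    prob {\<omega> \<in> space M. argmax_prefix (steps X is \<omega>) = length is} * prob {\<omega> \<in> space M. argmax_prefix (steps X js \<omega>) = 0}"
proof -
  let ?c = "count_space UNIV :: nat measure"
  let ?L = "\<lambda>is \<omega>. argmax_prefix (steps X is \<omega>)"
  have [measurable]: "?L ks \<in> measurable M ?c" if "set ks \<subseteq> I" for ks
    using that iid_measurable[OF assms(1)] by (intro measurable_steps_functionals) auto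
  have m [measurable]: "?L is \<in> measurable M ?c" "?L js \<in> measurable M ?c"
    using assms by auto
  interpret B: prob_space "distr M ?c (?L js)" by (intro prob_space_distr m)
  have "distr M (?c \<Otimes>\<^sub>M ?c) (\<lambda>\<omega>. (?L is \<omega>, ?L js \<omega>)) = distr M ?c (?L is) \<Otimes>\<^sub>M distr M ?c (?L js)"
    by (rule distr_steps_pair[OF assms]; intro measurable_argmax_prefix) auto
  then have "measure (distr M (?c \<Otimes>\<^sub>M ?c) (\<lambda>\<omega>. (?L is \<omega>, ?L js \<omega>))) ({length is} \<times> {0}) =
    measure (distr M ?c (?L is)) {length is} * measure (distr M ?c (?L js)) {0}"
    using B.emeasure_pair_measure_Times[of "{length is}" "distr M ?c (?L is)" "{0}"]
    by (simp add: measure_def enn2real_mult)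
  moreover have "measure (distr M (?c \<Otimes>\<^sub>M ?c) (\<lambda>\<omega>. (?L is \<omega>, ?L js \<omega>))) ({length is} \<times> {0}) =
    prob {\<omega> \<in> space M. ?L (is @ js) \<omega> = length is}"
  proof -
    have "?L (is @ js) \<omega> = length is \<longleftrightarrow> ?L is \<omega> = length is \<and> ?L js \<omega> = 0" for \<omega>
      using argmax_prefix_append_eq_length_iff[of "steps X is \<omega>" "steps X js \<omega>"] by (simp add: steps_def)
    moreover have "{(length is, 0)} \<in> sets (?c \<Otimes>\<^sub>M ?c)"
      using pair_measureI[of "{length is}" ?c "{0}" ?c] by simp
    ultimately show ?thesis
      by (subst measure_distr) (auto intro!: arg_cong[where f=prob])
  qed
  moreover have "measure (distr M ?c (?L ks)) {j} = prob {\<omega> \<in> space M. ?L ks \<omega> = j}" if "set ks \<subseteq> I" for ks j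
    using that by (subst measure_distr) (auto intro!: arg_cong[where f=prob])
  ultimately show ?thesis using assms by simp
qed

text \<open>By Fubini, conditioned on the earlier steps the last one would have to hit a single point.\<close>

lemma AE_sum_list_steps_nonzero:
  assumes "iid \<mu> X I" "set is \<subseteq> I" "distinct is" "is \<noteq> []" and no_atoms: "\<And>x. emeasure \<mu> {x} = 0"
  shows "AE \<omega> in M. sum_list (steps X is \<omega>) \<noteq> 0"
proof -
  obtain ks i where snoc: "is = ks @ [i]" using assms by (cases "is" rule: rev_cases) auto
  have i: "set ks \<subseteq> I" "i \<in> I" "i \<notin> set ks" using assms by (auto simp: snoc)
  have [measurable]: "X i \<in> borel_measurable M" using iid_measurable[OF assms(1)] i by auto
  have [measurable]: "(\<lambda>\<omega>. sum_list (steps X ks \<omega>)) \<in> borel_measurable M" using iid_measurable[OF assms(1)] i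
    by (intro measurable_steps_functionals) auto
  have \<mu>: "\<mu> = distr M borel (X i)" using assms(1) i by (simp add: iid_def)
  interpret \<mu>: prob_space \<mu> unfolding \<mu> by (rule prob_space_distr) simp
  have S [measurable_cong]: "sets \<mu> = sets borel" by (simp add: \<mu>)
  define \<nu> where "\<nu> = distr M borel (\<lambda>\<omega>. sum_list (steps X ks \<omega>))"
  have [measurable_cong]: "sets \<nu> = sets borel" by (simp add: \<nu>_def)
  have eq: "distr M (borel \<Otimes>\<^sub>M borel) (\<lambda>\<omega>. (sum_list (steps X ks \<omega>), X i \<omega>)) = \<nu> \<Otimes>\<^sub>M \<mu>"
    unfolding \<nu>_def by (rule distr_steps_last[OF assms(1) i]) auto
  have "emeasure (\<nu> \<Otimes>\<^sub>M \<mu>) {p \<in> space (\<nu> \<Otimes>\<^sub>M \<mu>). fst p + snd p = 0} = 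
     (\<integral>\<^sup>+ s. emeasure \<mu> (Pair s -` {p \<in> space (\<nu> \<Otimes>\<^sub>M \<mu>). fst p + snd p = 0}) \<partial>\<nu>)"
    by (rule \<mu>.emeasure_pair_measure_alt) measurable
  also have "\<dots> = (\<integral>\<^sup>+ s. 0 \<partial>\<nu>)"
  proof (intro nn_integral_cong)
    fix s
    have "Pair s -` {p \<in> space (\<nu> \<Otimes>\<^sub>M \<mu>). fst p + snd p = 0} = {-s}"
      by (auto simp: space_pair_measure sets_eq_imp_space_eq[OF S] \<nu>_def)
    then show "emeasure \<mu> (Pair s -` {p \<in> space (\<nu> \<Otimes>\<^sub>M \<mu>). fst p + snd p = 0}) = 0"
      using no_atoms by simp
  qed
  finally have "AE p in \<nu> \<Otimes>\<^sub>M \<mu>. fst p + snd p \<noteq> 0"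
    by (subst AE_iff_measurable[OF _ refl]) auto
  then have "AE \<omega> in M. sum_list (steps X ks \<omega>) + X i \<omega> \<noteq> 0"
    unfolding eq[symmetric] by (subst (asm) AE_distr_iff) auto
  then show ?thesis by (simp add: snoc steps_def)
qed

text \<open>The discrete arcsine law. With \<open>p m\<close> and \<open>q m\<close> the probabilities that the maximum of \<open>m\<close> steps is
  first attained at the end or at the start, the index of the maximum equals \<open>k\<close> with probability
  \<open>p k * q (n - k)\<close>. Reflection gives \<open>p = q\<close>, and total probability, used for every \<open>m \<le> n\<close>, makes
  \<open>p\<close> the same convolution square root as the arcsine weights.\<close>

theorem prob_pos_prefixes:
  assumes iid: "iid \<mu> X {..<n}"
    and sym: "\<And>i. i < n \<Longrightarrow> distr M borel (\<lambda>\<omega>. - X i \<omega>) = \<mu>"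
    and no_atoms: "\<And>x. emeasure \<mu> {x} = 0"
    and "k \<le> n"
  shows "prob {\<omega> \<in> space M. pos_prefixes (steps X [0..<n] \<omega>) = k} = arcsine_weight k * arcsine_weight (n - k)"
proof -
  let ?L = "\<lambda>m \<omega>. argmax_prefix (steps X [0..<m] \<omega>)"
  define p where "p m = prob {\<omega> \<in> space M. ?L m \<omega> = m}" for m
  define q where "q m = prob {\<omega> \<in> space M. ?L m \<omega> = 0}" for m
  have [measurable]: "X i \<in> borel_measurable M" if "i < n" for i
    using iid_measurable[OF iid] that by auto
  have neg: "iid \<mu> (\<lambda>i \<omega>. - X i \<omega>) {..<n}"
    using iid sym indep_vars_compose2[of "\<lambda>_. borel" X "{..<n}" "\<lambda>_ x. - x" "\<lambda>_. borel"]
    unfolding iid_def by auto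
  have law: "prob {\<omega> \<in> space M. ?L m \<omega> = j} = p j * q (m - j)" if "j \<le> m" "m \<le> n" for j m
  proof -
    have "prob {\<omega> \<in> space M. argmax_prefix (steps X ([0..<j] @ [j..<m]) \<omega>) = length [0..<j]} =
      prob {\<omega> \<in> space M. ?L j \<omega> = length [0..<j]} * prob {\<omega> \<in> space M. argmax_prefix (steps X [j..<m] \<omega>) = 0}"
      using that by (intro prob_argmax_append[OF iid]) auto
    moreover have "[0..<j] @ [j..<m] = [0..<m]"
      using that upt_add_eq_append[of 0 j "m - j"] by simp
    moreover have "prob {\<omega> \<in> space M. argmax_prefix (steps X [j..<m] \<omega>) = 0} = q (m - j)"
    proof -
      have "prob {\<omega> \<in> space M. argmax_prefix (steps X [j..<m] \<omega>) = 0} =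
          prob {\<omega> \<in> space M. pos_prefixes (steps X [0..<m - j] \<omega>) = 0}"
        using that by (intro prob_argmax_eq_prob_pos_prefixes[OF iid iid]) auto
      also have "\<dots> = q (m - j)"
        unfolding q_def using that
        by (intro prob_argmax_eq_prob_pos_prefixes[OF iid iid, symmetric]) auto
      finally show ?thesis .
    qed
    ultimately show ?thesis by (simp add: p_def)
  qed
  \<comment> \<open>Almost surely no prefix sum vanishes, so reflection turns none positive into all positive.\<close>
  have pq: "q m = p m" if "m \<le> n" for m
  proof -
    have "q m = prob {\<omega> \<in> space M. pos_prefixes (steps X [0..<m] \<omega>) = 0}"
      unfolding q_def using that by (intro prob_argmax_eq_prob_pos_prefixes[OF iid iid]) auto
    also have "\<dots> = prob {\<omega> \<in> space M. pos_prefixes (steps (\<lambda>i \<omega>. - X i \<omega>) [0..<m] \<omega>) = m}"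
    proof (rule measure_eq_AE)
      have "AE \<omega> in M. \<forall>j\<in>{1..m}. sum_list (steps X [0..<j] \<omega>) \<noteq> 0"
        using that by (intro AE_finite_allI AE_sum_list_steps_nonzero[OF iid]) (auto simp: no_atoms)
      then show "AE \<omega> in M. (\<omega> \<in> {\<omega> \<in> space M. pos_prefixes (steps X [0..<m] \<omega>) = 0}) =
          (\<omega> \<in> {\<omega> \<in> space M. pos_prefixes (steps (\<lambda>i \<omega>. - X i \<omega>) [0..<m] \<omega>) = m})"
      proof eventually_elim
        case (elim \<omega>)
        have *: "steps (\<lambda>i \<omega>. - X i \<omega>) [0..<m] \<omega> = map uminus (steps X [0..<m] \<omega>)"
          by (simp add: steps_def)
        have "pos_prefixes (steps X [0..<m] \<omega>) + pos_prefixes (map uminus (steps X [0..<m] \<omega>)) = length (steps X [0..<m] \<omega>)"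
          using elim by (intro pos_prefixes_uminus) (auto simp: steps_def take_map)
        then show ?case unfolding * by (auto simp: steps_def comp_def)
      qed
    qed (use that iid_measurable[OF neg] in \<open>auto intro!: measurable_sets_Collect[where P="\<lambda>k. k = _"] measurable_steps_functionals\<close>)
    also have "\<dots> = p m"
      unfolding p_def using that
      by (intro prob_argmax_eq_prob_pos_prefixes[OF iid neg, symmetric]) auto
    finally show ?thesis .
  qed
  have total: "(\<Sum>j\<le>m. p j * p (m - j)) = 1" if "m \<le> n" for m
  proof -
    have [measurable]: "?L m \<in> measurable M (count_space UNIV)"
      using that by (intro measurable_steps_functionals) auto
    have "(\<Sum>j\<le>m. p j * p (m - j)) = (\<Sum>j\<le>m. prob {\<omega> \<in> space M. ?L m \<omega> = j})"
      using that by (intro sum.cong) (auto simp: law pq)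
    also have "\<dots> = prob (\<Union>j\<le>m. {\<omega> \<in> space M. ?L m \<omega> = j})"
      by (intro finite_measure_finite_Union[symmetric]) (auto simp: disjoint_family_on_def)
    also have "(\<Union>j\<le>m. {\<omega> \<in> space M. ?L m \<omega> = j}) = space M"
      using argmax_prefix_le_length[of "steps X [0..<m] _"] by (auto simp: steps_def)
    finally show ?thesis by (simp add: prob_space)
  qed
  have p: "p m = arcsine_weight m" if "m \<le> n" for m
    using that by (intro convolution_square_root_unique[of p arcsine_weight n m])
      (auto simp: total arcsine_weight_convolution, simp add: p_def steps_def prob_space)
  have "prob {\<omega> \<in> space M. pos_prefixes (steps X [0..<n] \<omega>) = k} = prob {\<omega> \<in> space M. ?L n \<omega> = k}"
    by (intro prob_argmax_eq_prob_pos_prefixes[OF iid iid, symmetric]) auto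
  then show ?thesis using \<open>k \<le> n\<close> by (simp add: law pq p)
qed

end

section \<open>The arcsine law as a limit\<close>

text \<open>The usual form of this law has the density \<open>1 / (\<pi> * sqrt (y * (1 - y)))\<close> on \<open>(0, 1)\<close>; the
  angular form avoids improper integrals.\<close>

definition arcsine_law :: "real measure" where
  "arcsine_law = distr (density lborel (\<lambda>\<theta>. ennreal (2 / pi) * indicator {0..pi/2} \<theta>)) borel (\<lambda>\<theta>. (cos \<theta>)\<^sup>2)"

lemma emeasure_arcsine_law:
  assumes "B \<in> sets borel"
  shows "emeasure arcsine_law B = ennreal (2 / pi) * emeasure lborel {\<theta> \<in> {0..pi/2}. (cos \<theta>)\<^sup>2 \<in> B}"
proof -
  have [measurable]: "B \<in> sets borel" by fact
  have [measurable]: "(\<lambda>\<theta>::real. (cos \<theta>)\<^sup>2) -` B \<in> sets borel"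
    using measurable_sets[of "\<lambda>\<theta>::real. (cos \<theta>)\<^sup>2" borel borel B] by simp
  have "emeasure arcsine_law B = (\<integral>\<^sup>+ \<theta>. ennreal (2 / pi) * indicator {0..pi/2} \<theta> * indicator ((\<lambda>\<theta>. (cos \<theta>)\<^sup>2) -` B) \<theta> \<partial>lborel)"
    unfolding arcsine_law_def
    by (subst emeasure_distr) (auto simp: emeasure_density)
  also have "\<dots> = (\<integral>\<^sup>+ \<theta>. ennreal (2 / pi) * indicator {\<theta> \<in> {0..pi/2}. (cos \<theta>)\<^sup>2 \<in> B} \<theta> \<partial>lborel)"
    by (intro nn_integral_cong) (auto split: split_indicator)
  also have "\<dots> = ennreal (2 / pi) * emeasure lborel {\<theta> \<in> {0..pi/2}. (cos \<theta>)\<^sup>2 \<in> B}"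
    by (intro nn_integral_cmult_indicator) measurable
  finally show ?thesis .
qed

lemma real_distribution_arcsine_law: "real_distribution arcsine_law"
proof -
  have "emeasure arcsine_law UNIV = ennreal (2 / pi) * ennreal (pi / 2)"
    using emeasure_arcsine_law[of UNIV] emeasure_lborel_Icc[of 0 "pi / 2"]
    by (simp del: emeasure_lborel_Icc atLeastAtMost_iff)
  then have "prob_space arcsine_law"
    by (intro prob_spaceI) (simp add: arcsine_law_def flip: ennreal_mult)
  then show ?thesis
    by (simp add: real_distribution_def real_distribution_axioms_def arcsine_law_def)
qed

lemma integral_arcsine_law:
  fixes f :: "real \<Rightarrow> real"
  assumes "continuous_on UNIV f"
  shows "integral\<^sup>L arcsine_law f = 2 / pi * integral {0..pi/2} (\<lambda>\<theta>. f ((cos \<theta>)\<^sup>2))"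
proof -
  have [measurable]: "f \<in> borel_measurable borel"
    using assms by (rule borel_measurable_continuous_onI)
  have "integral\<^sup>L arcsine_law f = integral\<^sup>L (density lborel (\<lambda>\<theta>. ennreal (2 / pi * indicator {0..pi/2} \<theta>))) (\<lambda>\<theta>. f ((cos \<theta>)\<^sup>2))"
  proof -
    have "(\<lambda>\<theta>. ennreal (2 / pi) * indicator {0..pi/2} \<theta>) = (\<lambda>\<theta>. ennreal (2 / pi * indicator {0..pi/2} \<theta>))"
      by (auto simp: fun_eq_iff split: split_indicator)
    then show ?thesis
      unfolding arcsine_law_def by (subst integral_distr) auto
  qed
  also have "\<dots> = (LINT \<theta>|lborel. 2 / pi * (indicator {0..pi/2} \<theta> *\<^sub>R f ((cos \<theta>)\<^sup>2)))"
    by (subst integral_density) (auto simp: mult.assoc)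
  also have "\<dots> = 2 / pi * (LINT \<theta>:{0..pi/2}|lborel. f ((cos \<theta>)\<^sup>2))"
    by (simp add: set_lebesgue_integral_def)
  also have "(LINT \<theta>:{0..pi/2}|lborel. f ((cos \<theta>)\<^sup>2)) = integral {0..pi/2} (\<lambda>\<theta>. f ((cos \<theta>)\<^sup>2))"
    by (intro set_borel_integral_eq_integral borel_integrable_atLeastAtMost'
        continuous_on_compose2[OF assms] continuous_intros) auto
  finally show ?thesis .
qed

lemma weighted_Bernstein_tendsto_arcsine:
  fixes f :: "real \<Rightarrow> real"
  assumes f: "continuous_on UNIV f"
  shows "(\<lambda>n. \<Sum>k\<le>n. f (real k / real n) * (arcsine_weight k * arcsine_weight (n - k))) \<longlonglongrightarrow> integral\<^sup>L arcsine_law f"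
proof -
  let ?B = "\<lambda>n \<theta>. \<Sum>k\<le>n. f (real k / real n) * Bernstein n k ((cos \<theta>)\<^sup>2)"
  have "uniform_limit {0..pi/2} ?B (\<lambda>\<theta>. f ((cos \<theta>)\<^sup>2)) sequentially"
  proof (rule uniform_limitI)
    fix e :: real assume "0 < e"
    then obtain N where N: "\<And>n x. N \<le> n \<Longrightarrow> x \<in> {0..1} \<Longrightarrow> \<bar>f x - (\<Sum>k\<le>n. f (real k / real n) * Bernstein n k x)\<bar> < e"
      using Bernstein_Weierstrass[OF continuous_on_subset[OF f]] by (metis subset_UNIV)
    have "(cos \<theta>)\<^sup>2 \<in> {0..1}" for \<theta> :: real
      by (simp add: abs_square_le_1)
    then show "\<forall>\<^sub>F n in sequentially. \<forall>\<theta>\<in>{0..pi/2}. dist (?B n \<theta>) (f ((cos \<theta>)\<^sup>2)) < e"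
      using N unfolding dist_real_def
      by (intro eventually_sequentiallyI[of N]) (auto simp: abs_minus_commute)
  qed
  moreover have "continuous_on {0..pi/2} (?B n)" for n
    by (intro continuous_intros)
  ultimately obtain I J where I: "\<And>n. (?B n has_integral I n) {0..pi/2}"
    and J: "((\<lambda>\<theta>. f ((cos \<theta>)\<^sup>2)) has_integral J) {0..pi/2}" and IJ: "I \<longlonglongrightarrow> J"
    by (elim uniform_limit_integral) auto
  have "(\<Sum>k\<le>n. f (real k / real n) * (arcsine_weight k * arcsine_weight (n - k))) = 2 / pi * I n" for n
  proof -
    have "I n = integral {0..pi/2} (?B n)"
      using I[of n] by (simp add: integral_unique)
    also have "\<dots> = (\<Sum>k\<le>n. f (real k / real n) * integral {0..pi/2} (\<lambda>\<theta>. Bernstein n k ((cos \<theta>)\<^sup>2)))"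
      by (subst integral_sum) (auto intro!: integrable_continuous_real continuous_intros)
    finally have "2 / pi * I n = (\<Sum>k\<le>n. f (real k / real n) * (2 / pi * integral {0..pi/2} (\<lambda>\<theta>. Bernstein n k ((cos \<theta>)\<^sup>2))))"
      by (simp add: sum_distrib_left mult_ac)
    then show ?thesis by (simp add: integral_Bernstein_cos_squared del: times_divide_eq_left)
  qed
  moreover have "integral\<^sup>L arcsine_law f = 2 / pi * J"
    using integral_arcsine_law[OF f] J by (simp add: integral_unique)
  ultimately show ?thesis
    using tendsto_mult_left[OF IJ, of "2 / pi"] by simp
qed

lemma arcsine_law_no_atoms: "measure arcsine_law {y} = 0"
proof -
  have "\<theta> = \<theta>'" if "\<theta> \<in> {0..pi/2}" "\<theta>' \<in> {0..pi/2}" "(cos \<theta>)\<^sup>2 = (cos \<theta>')\<^sup>2" for \<theta> \<theta>' :: real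
  proof -
    have "0 \<le> cos \<theta>" "0 \<le> cos \<theta>'" using that by (auto intro!: cos_ge_zero)
    then have "cos \<theta> = cos \<theta>'" using that by (simp add: power2_eq_iff_nonneg)
    then show ?thesis using that cos_inj_pi[of \<theta> \<theta>'] by auto
  qed
  then have "\<exists>c. {\<theta> \<in> {0..pi/2}. (cos \<theta>)\<^sup>2 \<in> {y}} \<subseteq> {c}" by blast
  then have "emeasure lborel {\<theta> \<in> {0..pi/2}. (cos \<theta>)\<^sup>2 \<in> {y}} = 0"
    by (metis countable_empty countable_insert countable_subset emeasure_lborel_countable)
  then have "emeasure arcsine_law {y} = 0"
    using emeasure_arcsine_law[of "{y}"] by simp
  then show ?thesis by (simp add: measure_def)
qed

text \<open>Applied to a constant sequence, the criterion for weak convergence gives equality of the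
  distribution functions wherever the limiting one is continuous, which here is everywhere.\<close>

lemma real_distribution_eqI_continuous:
  assumes "real_distribution P" "real_distribution Q"
    and no_atoms: "\<And>y. measure Q {y} = 0"
    and eq: "\<And>f :: real \<Rightarrow> real. continuous_on UNIV f \<Longrightarrow> (\<And>y. f y \<in> {0..1}) \<Longrightarrow> integral\<^sup>L P f = integral\<^sup>L Q f"
  shows "P = Q"
proof -
  interpret P: real_distribution P by fact
  interpret Q: real_distribution Q by fact
  have "weak_conv_m (\<lambda>_. P) Q"
  proof (rule integral_cts_step_conv_imp_weak_conv)
    fix x y :: real assume "x < y"
    then have "integral\<^sup>L P (cts_step x y) = integral\<^sup>L Q (cts_step x y)"
      by (intro eq uniformly_continuous_imp_continuous cts_step_uniformly_continuous)
        (auto simp: cts_step_def divide_simps)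
    then show "(\<lambda>n. integral\<^sup>L P (cts_step x y)) \<longlonglongrightarrow> integral\<^sup>L Q (cts_step x y)" by simp
  qed (fact assms)+
  then have "cdf P y = cdf Q y" for y
    using Q.isCont_cdf[of y] no_atoms[of y]
    by (auto simp: weak_conv_m_def weak_conv_def LIMSEQ_const_iff)
  then show ?thesis using cdf_unique[OF assms(1,2)] by auto
qed

text \<open>Rounding up to the next grid point turns a Riemann sum over right end points into an integral, so
  that dominated convergence applies to Riemann sums.\<close>

lemma integral_ceiling_step:
  fixes g :: "nat \<Rightarrow> real"
  assumes "h > 0"
  shows "(LINT s:{0<..real n * h}|lborel. g (nat \<lceil>s / h\<rceil>)) = h * (\<Sum>k=1..n. g k)"
proof -
  have "indicator {0<..real n * h} s *\<^sub>R g (nat \<lceil>s / h\<rceil>) =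
      (\<Sum>k=1..n. g k * indicator {(real k - 1) * h<..real k * h} s)" for s
  proof -
    have iff: "s \<in> {(real k - 1) * h<..real k * h} \<longleftrightarrow> nat \<lceil>s / h\<rceil> = k \<and> 0 < s" if "k \<in> {1..n}" for k
    proof -
      have "s \<in> {(real k - 1) * h<..real k * h} \<longleftrightarrow> real k - 1 < s / h \<and> s / h \<le> real k"
        using assms by (auto simp: field_simps)
      also have "\<dots> \<longleftrightarrow> \<lceil>s / h\<rceil> = int k"
        by (auto simp: ceiling_eq_iff)
      also have "\<dots> \<longleftrightarrow> nat \<lceil>s / h\<rceil> = k \<and> 0 < s"
      proof -
        define c where "c = \<lceil>s / h\<rceil>"
        have "0 < s \<longleftrightarrow> 0 < c" unfolding c_def using assms by (simp add: zero_less_divide_iff)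
        then have "c = int k \<longleftrightarrow> nat c = k \<and> 0 < s" using that by auto
        then show ?thesis by (simp only: c_def)
      qed
      finally show ?thesis .
    qed
    have in_range: "s \<in> {0<..real n * h} \<longleftrightarrow> 0 < s \<and> nat \<lceil>s / h\<rceil> \<in> {1..n}"
    proof -
      define c where "c = \<lceil>s / h\<rceil>"
      have "s \<le> real n * h \<longleftrightarrow> c \<le> int n"
        unfolding c_def using assms by (simp add: ceiling_le_iff field_simps)
      moreover have "0 < s \<longleftrightarrow> 0 < c"
        unfolding c_def using assms by (simp add: zero_less_divide_iff)
      ultimately show ?thesis unfolding c_def[symmetric] by auto
    qed
    have "(\<Sum>k=1..n. g k * indicator {(real k - 1) * h<..real k * h} s) =
        (\<Sum>k=1..n. if nat \<lceil>s / h\<rceil> = k then (if 0 < s then g k else 0) else 0)"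
    proof (intro sum.cong refl)
      fix k assume "k \<in> {1..n}"
      from iff[OF this] show "g k * indicator {(real k - 1) * h<..real k * h} s =
          (if nat \<lceil>s / h\<rceil> = k then (if 0 < s then g k else 0) else 0)"
        by (simp only: indicator_def) simp
    qed
    also have "\<dots> = (if 0 < s \<and> nat \<lceil>s / h\<rceil> \<in> {1..n} then g (nat \<lceil>s / h\<rceil>) else 0)"
      by (simp add: sum.delta')
    also have "\<dots> = indicator {0<..real n * h} s *\<^sub>R g (nat \<lceil>s / h\<rceil>)"
      unfolding indicator_def in_range by simp
    finally show ?thesis ..
  qed
  then have "(LINT s:{0<..real n * h}|lborel. g (nat \<lceil>s / h\<rceil>)) =
      (LINT s|lborel. (\<Sum>k=1..n. g k * indicator {(real k - 1) * h<..real k * h} s))"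
    by (simp add: set_lebesgue_integral_def)
  also have "\<dots> = (\<Sum>k=1..n. g k * h)"
    using assms by (subst Bochner_Integration.integral_sum)
      (auto intro!: integrable_mult_right sum.cong simp: algebra_simps)
  finally show ?thesis by (simp add: sum_distrib_left mult.commute)
qed

lemma ceiling_grid_tendsto:
  fixes s T :: real
  assumes "0 < T" "0 \<le> s"
  shows "(\<lambda>n. real (nat \<lceil>s / (T / real (Suc n))\<rceil>) * (T / real (Suc n))) \<longlonglongrightarrow> s"
proof (rule tendsto_sandwich[OF always_eventually always_eventually])
  show "\<forall>n. s \<le> real (nat \<lceil>s / (T / real (Suc n))\<rceil>) * (T / real (Suc n))"
  proof
    fix n
    have h: "T / real (Suc n) > 0" using assms by simp
    have "s = s / (T / real (Suc n)) * (T / real (Suc n))" using assms by simp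
    also have "\<dots> \<le> real (nat \<lceil>s / (T / real (Suc n))\<rceil>) * (T / real (Suc n))"
      using h by (intro mult_right_mono real_nat_ceiling_ge) auto
    finally show "s \<le> real (nat \<lceil>s / (T / real (Suc n))\<rceil>) * (T / real (Suc n))" .
  qed
  show "\<forall>n. real (nat \<lceil>s / (T / real (Suc n))\<rceil>) * (T / real (Suc n)) \<le> s + T / real (Suc n)"
  proof
    fix n
    have h: "T / real (Suc n) > 0" using assms by simp
    have "0 \<le> s / (T / real (Suc n))" using h assms by simp
    then have "real (nat \<lceil>s / (T / real (Suc n))\<rceil>) \<le> s / (T / real (Suc n)) + 1"
      by linarith
    then have "real (nat \<lceil>s / (T / real (Suc n))\<rceil>) * (T / real (Suc n)) \<le> (s / (T / real (Suc n)) + 1) * (T / real (Suc n))"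
      using h by (intro mult_right_mono) auto
    also have "\<dots> = s + T / real (Suc n)" 
    proof -
      have "(s / h + 1) * h = s + h" if "h > 0" for h using that by (simp add: field_simps)
      from this[OF h] show ?thesis .
    qed
    finally show "real (nat \<lceil>s / (T / real (Suc n))\<rceil>) * (T / real (Suc n)) \<le> s + T / real (Suc n)" .
  qed
  have "(\<lambda>n. T / real (Suc n)) \<longlonglongrightarrow> 0" 
    using LIMSEQ_Suc[OF lim_const_over_n[of T]] by simp
  from tendsto_add[OF tendsto_const[of s] this] show "(\<lambda>n. s + T / real (Suc n)) \<longlonglongrightarrow> s" by simp
qed simp

section \<open>Occupation times of Brownian motion\<close>

context standard_brownian_motion
begin

lemma grid_path_converges:
  assumes "\<omega> \<in> space M" "0 < T" "0 \<le> s"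
  shows "(\<lambda>n. W (real (nat \<lceil>s / (T / real (Suc n))\<rceil>) * (T / real (Suc n))) \<omega>) \<longlonglongrightarrow> W s \<omega>"
proof (rule continuous_on_tendsto_compose[OF continuous_paths ceiling_grid_tendsto])
  show "\<forall>\<^sub>F n in sequentially. real (nat \<lceil>s / (T / real (Suc n))\<rceil>) * (T / real (Suc n)) \<in> {0..}"
    unfolding atLeast_iff using assms
    by (intro always_eventually allI mult_nonneg_nonneg of_nat_0_le_iff divide_nonneg_nonneg) auto
qed (use assms in auto)

text \<open>The process is the pointwise limit of its values at the next point of ever finer grids, by
  continuity of paths. Times are clipped at \<open>0\<close> since \<open>W\<close> is unconstrained at negative times.\<close>

lemma measurable_process: "(\<lambda>p. W (max 0 (fst p)) (snd p)) \<in> borel_measurable (borel \<Otimes>\<^sub>M M)"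
proof (rule borel_measurable_LIMSEQ_metric)
  fix n
  let ?h = "1 / real (Suc n)"
  show "(\<lambda>p. W (real (nat \<lceil>max 0 (fst p) / ?h\<rceil>) * ?h) (snd p)) \<in> borel_measurable (borel \<Otimes>\<^sub>M M)"
  proof (rule measurable_compose_countable[where f="\<lambda>k p. W (real k * ?h) (snd p)"])
    fix k :: nat
    have [measurable]: "W (real k * ?h) \<in> borel_measurable M"
      by (rule random_variable_W) simp
    show "(\<lambda>p. W (real k * ?h) (snd p)) \<in> borel_measurable (borel \<Otimes>\<^sub>M M)" by measurable
  qed measurable
next
  fix p assume "p \<in> space (borel \<Otimes>\<^sub>M M :: (real \<times> 'a) measure)"
  then show "(\<lambda>n. W (real (nat \<lceil>max 0 (fst p) / (1 / real (Suc n))\<rceil>) * (1 / real (Suc n))) (snd p))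
      \<longlonglongrightarrow> W (max 0 (fst p)) (snd p)"
    by (intro grid_path_converges) (auto simp: space_pair_measure)
qed

lemma measurable_process_compose [measurable (raw)]:
  assumes "f \<in> borel_measurable N" "g \<in> measurable N M"
  shows "(\<lambda>x. W (max 0 (f x)) (g x)) \<in> borel_measurable N"
  using measurable_compose[OF measurable_Pair[OF assms] measurable_process] by simp

lemma AE_nonzero:
  assumes "0 < t"
  shows "AE \<omega> in M. W t \<omega> \<noteq> 0"
proof -
  have "distributed M lborel (\<lambda>\<omega>. W t \<omega> - W 0 \<omega>) (normal_density 0 (sqrt (t - 0)))"
    using assms by (intro normal_increments) auto
  then have "AE \<omega> in M. W t \<omega> - W 0 \<omega> \<noteq> 0"
    using distributed_AE2[of lborel "\<lambda>\<omega>. W t \<omega> - W 0 \<omega>" _ "\<lambda>x. x \<noteq> 0"] AE_lborel_singleton[of "0::real"]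
    by auto
  with start_zero show ?thesis by eventually_elim simp
qed

text \<open>Each single positive time is almost surely not a zero; Fubini exchanges the quantifiers over
  times and paths.\<close>

lemma AE_AE_nonzero: "AE \<omega> in M. AE s in lborel. 0 < s \<longrightarrow> W s \<omega> \<noteq> 0"
proof -
  interpret pair_sigma_finite lborel M ..
  have "AE s in lborel. AE \<omega> in M. 0 < s \<longrightarrow> W (max 0 s) \<omega> \<noteq> 0"
    using AE_nonzero by (auto intro!: AE_I2 simp: max_def)
  then have "AE \<omega> in M. AE s in lborel. 0 < s \<longrightarrow> W (max 0 s) \<omega> \<noteq> 0"
  proof (subst (asm) AE_commute)
    have "{p \<in> space (borel \<Otimes>\<^sub>M M). 0 < fst p \<longrightarrow> W (max 0 (fst p)) (snd p) \<noteq> 0} \<in> sets (borel \<Otimes>\<^sub>M M)"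
      by measurable
    then show "{p \<in> space (lborel \<Otimes>\<^sub>M M). 0 < fst p \<longrightarrow> W (max 0 (fst p)) (snd p) \<noteq> 0} \<in> sets (lborel \<Otimes>\<^sub>M M)"
      by (simp add: space_pair_measure cong: sets_pair_measure_cong)
  qed
  then show ?thesis
  proof eventually_elim
    case (elim \<omega>)
    then show ?case by eventually_elim (auto simp: max_def)
  qed
qed

definition occupation :: "real \<Rightarrow> 'a \<Rightarrow> real" where
  "occupation T \<omega> = (LINT s:{0..T}|lborel. indicator {0..} (W s \<omega>))"

lemma measurable_path_section: 
  assumes "\<omega> \<in> space M"
  shows "(\<lambda>s. indicator {0..T} s *\<^sub>R (indicator {0..} (W s \<omega>) :: real)) \<in> borel_measurable borel"
proof -
  have [measurable]: "(\<lambda>s. W (max 0 s) \<omega>) \<in> borel_measurable borel"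
    using assms by measurable
  have "(\<lambda>s. indicator {0..T} s *\<^sub>R (indicator {0..} (W (max 0 s) \<omega>) :: real)) \<in> borel_measurable borel"
    by measurable
  also have "(\<lambda>s. indicator {0..T} s *\<^sub>R (indicator {0..} (W (max 0 s) \<omega>) :: real)) =
      (\<lambda>s. indicator {0..T} s *\<^sub>R indicator {0..} (W s \<omega>))"
    by (auto simp: fun_eq_iff indicator_def)
  finally show ?thesis .
qed

lemma measurable_occupation [measurable]: "occupation T \<in> borel_measurable M"
proof -
  have "(\<lambda>\<omega>. LINT s|lborel. indicator {0..T} s *\<^sub>R (indicator {0..} (W (max 0 s) \<omega>) :: real)) \<in> borel_measurable M"
    by measurable
  also have "(\<lambda>\<omega>. LINT s|lborel. indicator {0..T} s *\<^sub>R (indicator {0..} (W (max 0 s) \<omega>) :: real)) = occupation T"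
    unfolding occupation_def set_lebesgue_integral_def
    by (intro ext Bochner_Integration.integral_cong) (auto simp: indicator_def)
  finally show ?thesis .
qed

definition grid_increment :: "real \<Rightarrow> nat \<Rightarrow> 'a \<Rightarrow> real" where
  "grid_increment h i \<omega> = W (real (Suc i) * h) \<omega> - W (real i * h) \<omega>"

lemma distributed_grid_increment:
  assumes "0 < h"
  shows "distributed M lborel (grid_increment h i) (normal_density 0 (sqrt h))"
proof -
  have "distributed M lborel (\<lambda>\<omega>. W (real (Suc i) * h) \<omega> - W (real i * h) \<omega>)
      (normal_density 0 (sqrt (real (Suc i) * h - real i * h)))"
    using assms by (intro normal_increments) (auto intro: mult_strict_right_mono)
  then show ?thesis
    unfolding grid_increment_def[abs_def] by (simp add: algebra_simps)
qed

lemma distr_borel_normal: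
  assumes "distributed M lborel X (normal_density 0 \<sigma>)"
  shows "distr M borel X = density lborel (normal_density 0 \<sigma>)"
proof -
  have "distr M borel X = distr M lborel X" by (intro distr_cong) auto
  then show ?thesis using assms by (simp add: distributed_def)
qed

lemma iid_grid_increment:
  assumes "0 < h"
  shows "iid (density lborel (normal_density 0 (sqrt h))) (grid_increment h) {..<n}"
proof -
  have "indep_vars (\<lambda>_. borel) (grid_increment h) {..<n}"
    unfolding grid_increment_def[abs_def] using assms
    by (intro indep_increments) (auto intro: mult_strict_right_mono)
  then show ?thesis
    unfolding iid_def using distr_borel_normal[OF distributed_grid_increment[OF assms]] by auto
qed

lemma distr_minus_grid_increment:
  assumes "0 < h"
  shows "distr M borel (\<lambda>\<omega>. - grid_increment h i \<omega>) = density lborel (normal_density 0 (sqrt h))"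
  using normal_density_affine[OF distributed_grid_increment[OF assms], of "-1" 0 i] assms
  by (intro distr_borel_normal) simp

definition grid_count :: "real \<Rightarrow> nat \<Rightarrow> 'a \<Rightarrow> nat" where
  "grid_count T n \<omega> = pos_prefixes (steps (grid_increment (T / real n)) [0..<n] \<omega>)"

lemma prob_grid_count:
  assumes "0 < T" "k \<le> n" "0 < n"
  shows "prob {\<omega> \<in> space M. grid_count T n \<omega> = k} = arcsine_weight k * arcsine_weight (n - k)"
  unfolding grid_count_def
proof (rule prob_pos_prefixes)
  show "iid (density lborel (normal_density 0 (sqrt (T / real n)))) (grid_increment (T / real n)) {..<n}"
    using assms by (intro iid_grid_increment) auto
  show "distr M borel (\<lambda>\<omega>. - grid_increment (T / real n) i \<omega>) = density lborel (normal_density 0 (sqrt (T / real n)))" for i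
    using assms by (intro distr_minus_grid_increment) auto
  show "emeasure (density lborel (normal_density 0 (sqrt (T / real n)))) {x} = 0" for x
    by (subst emeasure_density) (auto simp: nn_integral_cmult_indicator nn_integral_0_iff_AE intro!: AE_mp[OF AE_lborel_singleton[of x]])
qed fact

lemma grid_count_eq_sum:
  assumes "W 0 \<omega> = 0"
  shows "real (grid_count T n \<omega>) = (\<Sum>k=1..n. indicator {0<..} (W (real k * (T / real n)) \<omega>))"
proof -
  have "sum_list (take k (steps (grid_increment (T / real n)) [0..<n] \<omega>)) = W (real k * (T / real n)) \<omega>" if "k \<le> n" for k
    using that
  proof (induction k)
    case (Suc k)
    then show ?case by (simp add: take_Suc_conv_app_nth steps_def grid_increment_def)
  qed (simp add: assms)
  then show ?thesis
    unfolding grid_count_def pos_prefixes_def of_nat_sum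
    by (intro sum.cong) (auto simp: steps_def indicator_def)
qed

lemma grid_count_le: "grid_count T n \<omega> \<le> n"
proof -
  have "pos_prefixes xs \<le> length xs" for xs
    using sum_bounded_above[of "{1..length xs}" "\<lambda>k. if sum_list (take k xs) > 0 then 1 else 0" "1::nat"]
    by (simp add: pos_prefixes_def)
  from this[of "steps (grid_increment (T / real n)) [0..<n] \<omega>"] show ?thesis
    by (simp add: grid_count_def steps_def)
qed

lemma measurable_grid_count:
  assumes "0 < T" "0 < n"
  shows "grid_count T n \<in> measurable M (count_space UNIV)"
  unfolding grid_count_def[abs_def]
  using assms iid_measurable[OF iid_grid_increment[of "T / real n" n]]
  by (intro measurable_steps_functionals) auto

text \<open>Away from its zeros, the sign of a continuous path at \<open>s\<close> is eventually its sign at the next grid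
  point. Since the zeros form a null set, the strict inequality in the count and the weak one in the
  occupation time have the same limit.\<close>

lemma grid_count_tendsto_occupation:
  assumes "0 < T"
  shows "AE \<omega> in M. (\<lambda>n. real (grid_count T (Suc n) \<omega>) / real (Suc n)) \<longlonglongrightarrow> occupation T \<omega> / T"
  using AE_AE_nonzero start_zero AE_space
proof eventually_elim
  case (elim \<omega>)
  let ?h = "\<lambda>n. T / real (Suc n)"
  let ?g = "\<lambda>n s. W (real (nat \<lceil>s / ?h n\<rceil>) * ?h n) \<omega>"
  have "real (grid_count T (Suc n) \<omega>) / real (Suc n) = (LINT s:{0<..T}|lborel. indicator {0<..} (?g n s)) / T" for n
  proof -
    have "real (grid_count T (Suc n) \<omega>) / real (Suc n) = (?h n * (\<Sum>k=1..Suc n. indicator {0<..} (W (real k * ?h n) \<omega>))) / T"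
      using assms grid_count_eq_sum[OF elim(2), of T "Suc n"] by simp
    also have "?h n * (\<Sum>k=1..Suc n. indicator {0<..} (W (real k * ?h n) \<omega>)) =
        (LINT s:{0<..real (Suc n) * ?h n}|lborel. indicator {0<..} (?g n s))"
      using assms by (intro integral_ceiling_step[symmetric]) auto
    also have "real (Suc n) * ?h n = T" by simp
    finally show ?thesis .
  qed
  moreover have "(\<lambda>n. LINT s|lborel. indicator {0<..T} s *\<^sub>R (indicator {0<..} (?g n s) :: real)) \<longlonglongrightarrow>
      (LINT s|lborel. indicator {0..T} s *\<^sub>R indicator {0..} (W s \<omega>))"
  proof (rule integral_dominated_convergence[where w="indicator {0..T}"])
    show "(\<lambda>s. indicator {0..T} s *\<^sub>R (indicator {0..} (W s \<omega>) :: real)) \<in> borel_measurable lborel"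
      using measurable_path_section[OF elim(3)] by simp
    show "(\<lambda>s. indicator {0<..T} s *\<^sub>R (indicator {0<..} (?g n s) :: real)) \<in> borel_measurable lborel" for n
    proof -
      have "(\<lambda>s. indicator {0<..} (?g n s) :: real) \<in> borel_measurable borel"
        by (rule measurable_compose_countable[where f="\<lambda>k s. indicator {0<..} (W (real k * ?h n) \<omega>)"]) measurable
      then show ?thesis by measurable
    qed
    show "AE s in lborel. (\<lambda>n. indicator {0<..T} s *\<^sub>R (indicator {0<..} (?g n s) :: real)) \<longlonglongrightarrow>
        indicator {0..T} s *\<^sub>R indicator {0..} (W s \<omega>)"
      using elim(1) AE_lborel_singleton[of "0::real"]
    proof eventually_elim
      case (elim s)
      show ?case
      proof (cases "s \<in> {0<..T}")
        case True
        then have lim: "(\<lambda>n. ?g n s) \<longlonglongrightarrow> W s \<omega>" and nz: "W s \<omega> \<noteq> 0"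
          using elim assms grid_path_converges[OF \<open>\<omega> \<in> space M\<close>, of T s] by auto
        have "\<forall>\<^sub>F n in sequentially. (indicator {0<..} (?g n s) :: real) = indicator {0..} (W s \<omega>)"
        proof (cases "W s \<omega> > 0")
          case True
          from order_tendstoD(1)[OF lim this] show ?thesis
            by eventually_elim (use True in auto)
        next
          case False
          then have "W s \<omega> < 0" using nz by simp
          from order_tendstoD(2)[OF lim this] show ?thesis
            by eventually_elim (use \<open>W s \<omega> < 0\<close> in auto)
        qed
        then have "(\<lambda>n. indicator {0<..} (?g n s) :: real) \<longlonglongrightarrow> indicator {0..} (W s \<omega>)"
          by (rule tendsto_eventually)
        then show ?thesis using True by simp
      next
        case False
        then have "s \<notin> {0<..T}" "s \<notin> {0..T}" using elim(2) by auto
        then show ?thesis by simp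
      qed
    qed
    show "integrable lborel (indicator {0..T} :: real \<Rightarrow> real)"
      by (intro integrable_real_indicator) (auto simp: emeasure_lborel_Icc_eq)
  qed (auto simp: indicator_def)
  ultimately show ?case
    unfolding occupation_def set_lebesgue_integral_def
    using tendsto_divide[OF _ tendsto_const[of T]] assms by simp
qed

theorem levy_arcsine_law:
  assumes "0 < T"
  shows "distr M borel (\<lambda>\<omega>. occupation T \<omega> / T) = arcsine_law"
proof (rule real_distribution_eqI_continuous)
  show "real_distribution (distr M borel (\<lambda>\<omega>. occupation T \<omega> / T))"
    by (intro real_distribution_distr) simp
  fix f :: "real \<Rightarrow> real" assume f: "continuous_on UNIV f" and bound: "\<And>y. f y \<in> {0..1}"
  have [measurable]: "f \<in> borel_measurable borel"
    using f by (rule borel_measurable_continuous_onI)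
  note [measurable] = measurable_grid_count[OF assms]
  let ?N = "\<lambda>n \<omega>. grid_count T (Suc n) \<omega>"
  have "(\<lambda>n. expectation (\<lambda>\<omega>. f (real (?N n \<omega>) / real (Suc n)))) \<longlonglongrightarrow> expectation (\<lambda>\<omega>. f (occupation T \<omega> / T))"
  proof (rule integral_dominated_convergence[where w="\<lambda>_. 1"])
    show "AE \<omega> in M. (\<lambda>n. f (real (?N n \<omega>) / real (Suc n))) \<longlonglongrightarrow> f (occupation T \<omega> / T)"
      using grid_count_tendsto_occupation[OF assms]
      by eventually_elim (auto intro: continuous_on_tendsto_compose[OF f])
  qed (use bound in auto)
  moreover have "expectation (\<lambda>\<omega>. f (real (?N n \<omega>) / real (Suc n))) =
      (\<Sum>k\<le>Suc n. f (real k / real (Suc n)) * (arcsine_weight k * arcsine_weight (Suc n - k)))" for n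
  proof -
    have "expectation (\<lambda>\<omega>. f (real (?N n \<omega>) / real (Suc n))) =
        expectation (\<lambda>\<omega>. \<Sum>k\<le>Suc n. f (real k / real (Suc n)) * indicator {\<omega> \<in> space M. ?N n \<omega> = k} \<omega>)"
    proof (intro Bochner_Integration.integral_cong refl)
      fix \<omega> assume "\<omega> \<in> space M"
      then have "(\<Sum>k\<le>Suc n. f (real k / real (Suc n)) * indicator {\<omega> \<in> space M. ?N n \<omega> = k} \<omega>) =
          (\<Sum>k\<le>Suc n. if ?N n \<omega> = k then f (real k / real (Suc n)) else 0)"
        by (intro sum.cong) (auto simp: indicator_def)
      also have "\<dots> = f (real (?N n \<omega>) / real (Suc n))"
        using grid_count_le[of T "Suc n" \<omega>] by (subst sum.delta') auto
      finally show "f (real (?N n \<omega>) / real (Suc n)) = (\<Sum>k\<le>Suc n. f (real k / real (Suc n)) * indicator {\<omega> \<in> space M. ?N n \<omega> = k} \<omega>)" ..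
    qed
    also have "\<dots> = (\<Sum>k\<le>Suc n. f (real k / real (Suc n)) * prob ({\<omega> \<in> space M. ?N n \<omega> = k} \<inter> space M))"
      by (subst Bochner_Integration.integral_sum) (auto intro!: integrable_mult_right integrable_real_indicator simp: emeasure_eq_measure)
    also have "\<dots> = (\<Sum>k\<le>Suc n. f (real k / real (Suc n)) * prob {\<omega> \<in> space M. ?N n \<omega> = k})"
      by (intro sum.cong arg_cong2[where f="(*)"] arg_cong[where f=prob]) auto
    also have "\<dots> = (\<Sum>k\<le>Suc n. f (real k / real (Suc n)) * (arcsine_weight k * arcsine_weight (Suc n - k)))"
      using assms by (intro sum.cong) (auto simp: prob_grid_count)
    finally show ?thesis .
  qed
  moreover have "(\<lambda>n. \<Sum>k\<le>Suc n. f (real k / real (Suc n)) * (arcsine_weight k * arcsine_weight (Suc n - k)))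
      \<longlonglongrightarrow> integral\<^sup>L arcsine_law f"
    using LIMSEQ_Suc[OF weighted_Bernstein_tendsto_arcsine[OF f]] .
  ultimately have "expectation (\<lambda>\<omega>. f (occupation T \<omega> / T)) = integral\<^sup>L arcsine_law f"
    by (metis (no_types, lifting) LIMSEQ_unique ext)
  then show "integral\<^sup>L (distr M borel (\<lambda>\<omega>. occupation T \<omega> / T)) f = integral\<^sup>L arcsine_law f"
    by (simp add: integral_distr)
qed (rule real_distribution_arcsine_law arcsine_law_no_atoms)+

section \<open>The angle of the occupation vector\<close>

lemma integrable_path_section:
  assumes "\<omega> \<in> space M"
  shows "integrable lborel (\<lambda>s. indicator {0..T} s *\<^sub>R (indicator {0..} (W s \<omega>) :: real))"
proof (rule Bochner_Integration.integrable_bound)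
  show "integrable lborel (indicator {0..T} :: real \<Rightarrow> real)"
    by (intro integrable_real_indicator) (auto simp: emeasure_lborel_Icc_eq)
qed (use measurable_path_section[OF assms] in \<open>auto simp: indicator_def\<close>)

lemma occupation_bounds:
  assumes "\<omega> \<in> space M" "0 \<le> T"
  shows "0 \<le> occupation T \<omega>" "occupation T \<omega> \<le> T"
proof -
  show "0 \<le> occupation T \<omega>"
    unfolding occupation_def set_lebesgue_integral_def by (intro integral_nonneg_AE) auto
  have "occupation T \<omega> \<le> (LINT s|lborel. indicator {0..T} s)"
    unfolding occupation_def set_lebesgue_integral_def
    by (intro integral_mono integrable_path_section[OF assms(1)] integrable_real_indicator)
      (auto simp: indicator_def emeasure_lborel_Icc_eq)
  then show "occupation T \<omega> \<le> T" using assms by simp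
qed

lemma Z_eq_occupation:
  assumes "\<omega> \<in> space M" "0 \<le> u"
  shows "Z W u \<omega> = occupation (3 * u / 7) \<omega> *\<^sub>R e1 + (3 * u / 7 - occupation (3 * u / 7) \<omega>) *\<^sub>R e2"
proof -
  let ?T = "3 * u / 7"
  have "Z W u \<omega> = (LINT s|lborel. (indicator {0..?T} s *\<^sub>R (indicator {0..} (W s \<omega>) :: real)) *\<^sub>R (e1 - e2)
      + (indicator {0..?T} s :: real) *\<^sub>R e2)"
    unfolding Z_def set_lebesgue_integral_def
    by (intro Bochner_Integration.integral_cong) (auto simp: indicator_def)
  also have "\<dots> = occupation ?T \<omega> *\<^sub>R (e1 - e2) + ?T *\<^sub>R e2"
    using assms integrable_path_section[OF assms(1), of ?T]
    by (subst Bochner_Integration.integral_add)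
      (auto simp: occupation_def set_lebesgue_integral_def emeasure_lborel_Icc_eq
        simp del: real_scaleR_def intro!: integrable_scaleR_left integrable_real_indicator)
  finally show ?thesis by (simp add: algebra_simps)
qed

end

text \<open>After squaring, \<open>cos x \<le> a / r\<close> with \<open>r\<close> the length of the vector becomes
  \<open>cos x * (t - a) \<le> sin x * a\<close>, which is linear in \<open>a\<close>.\<close>

lemma angle_e1_le_iff:
  assumes "0 \<le> a" "a \<le> t" "0 < t" "x \<in> {0..<pi / 2}"
  shows "angle (a *\<^sub>R e1 + (t - a) *\<^sub>R e2) e1 \<le> x \<longleftrightarrow> 1 / (1 + tan x) \<le> a / t"
proof -
  define r where "r = sqrt (a\<^sup>2 + (t - a)\<^sup>2)"
  have ip: "inner e1 e1 = 1" "inner e2 e2 = 1" "inner e1 e2 = 0" "inner e2 e1 = 0"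
    by (simp_all add: e1_def e2_def inner_axis_axis)
  have "0 < a\<^sup>2 + (t - a)\<^sup>2" using assms by (auto simp: sum_power2_gt_zero_iff)
  then have r: "0 < r" "r\<^sup>2 = a\<^sup>2 + (t - a)\<^sup>2" by (auto simp: r_def)
  have "a \<le> r" unfolding r_def by (intro real_le_rsqrt) simp
  have cs: "0 < cos x" "0 \<le> sin x" "(sin x)\<^sup>2 + (cos x)\<^sup>2 = 1" using assms by (auto intro!: cos_gt_zero_pi sin_ge_zero)
  have angle_eq: "angle (a *\<^sub>R e1 + (t - a) *\<^sub>R e2) e1 = arccos (a / r)"
    by (simp add: angle_def norm_eq_sqrt_inner inner_add_left inner_add_right ip r_def power2_eq_square)
  have "arccos (a / r) \<le> x \<longleftrightarrow> cos x \<le> a / r"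
  proof -
    have "x = arccos (cos x)" using assms by (intro arccos_cos[symmetric]) auto
    then have "arccos (a / r) \<le> x \<longleftrightarrow> arccos (a / r) \<le> arccos (cos x)" by simp
    also have "\<dots> \<longleftrightarrow> cos x \<le> a / r"
      using r \<open>a \<le> r\<close> assms by (intro arccos_le_mono) (auto simp: abs_le_iff field_simps intro: order_trans[of _ 0])
    finally show ?thesis .
  qed
  also have "\<dots> \<longleftrightarrow> cos x * r \<le> a" using r by (simp add: field_simps)
  also have "\<dots> \<longleftrightarrow> (cos x * r)\<^sup>2 \<le> a\<^sup>2"
    using cs r assms by (simp add: abs_le_square_iff[symmetric])
  also have "\<dots> \<longleftrightarrow> (cos x * (t - a))\<^sup>2 \<le> (sin x * a)\<^sup>2"
  proof -
    have "a\<^sup>2 = ((sin x)\<^sup>2 + (cos x)\<^sup>2) * a\<^sup>2" using cs by simp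
    then show ?thesis unfolding power_mult_distrib r(2) distrib_left distrib_right by linarith
  qed
  also have "\<dots> \<longleftrightarrow> cos x * (t - a) \<le> sin x * a"
    using cs assms by (simp add: abs_le_square_iff[symmetric] abs_mult)
  also have "\<dots> \<longleftrightarrow> 1 / (1 + tan x) \<le> a / t"
  proof -
    have eq: "1 / (1 + tan x) = cos x / (cos x + sin x)" using cs by (simp add: tan_def field_simps)
    have "0 < cos x + sin x" using cs by simp
    then show ?thesis unfolding eq using assms(3) by (simp add: field_simps)
  qed
  finally show ?thesis unfolding angle_eq .
qed

text \<open>The bound is \<open>cos\<^sup>2 \<phi>\<close> for \<open>\<phi> = arctan (sqrt t)\<close>, so the event is that the uniform angle is at most \<open>\<phi>\<close>.\<close>

lemma measure_arcsine_law_atLeast: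
  assumes "0 \<le> t"
  shows "measure arcsine_law {1 / (1 + t)..} = 2 / pi * arctan (sqrt t)"
proof -
  let ?\<phi> = "arctan (sqrt t)"
  have \<phi>: "0 \<le> ?\<phi>" "?\<phi> < pi / 2" using assms arctan_ubound[of "sqrt t"] by simp_all
  have c: "(cos ?\<phi>)\<^sup>2 = 1 / (1 + t)" using assms by (simp add: cos_arctan power_divide)
  have "(cos \<theta>)\<^sup>2 \<in> {1 / (1 + t)..} \<longleftrightarrow> \<theta> \<le> ?\<phi>" if "\<theta> \<in> {0..pi/2}" for \<theta>
  proof -
    have "0 \<le> cos \<theta>" using that by (auto intro!: cos_ge_zero)
    moreover have "0 \<le> cos ?\<phi>" using \<phi> pi_gt_zero by (intro cos_ge_zero) linarith+
    ultimately have "(cos \<theta>)\<^sup>2 \<in> {1 / (1 + t)..} \<longleftrightarrow> cos ?\<phi> \<le> cos \<theta>"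
      unfolding c[symmetric] by (simp add: abs_le_square_iff[symmetric])
    also have "\<dots> \<longleftrightarrow> \<theta> \<le> ?\<phi>"
      using that \<phi> by (intro cos_mono_le_eq) auto
    finally show ?thesis .
  qed
  then have "{\<theta> \<in> {0..pi/2}. (cos \<theta>)\<^sup>2 \<in> {1 / (1 + t)..}} = {0..?\<phi>}"
    using \<phi> by auto
  then have "emeasure arcsine_law {1 / (1 + t)..} = ennreal (2 / pi) * ennreal ?\<phi>"
    using emeasure_arcsine_law[of "{1 / (1 + t)..}"] \<phi> by simp
  also have "\<dots> = ennreal (2 / pi * ?\<phi>)"
    using \<phi> by (intro ennreal_mult[symmetric]) auto
  finally show ?thesis using \<phi> by (simp add: measure_def)
qed

theorem mainTheorem3:
  fixes M :: "'a measure" and W :: "real \<Rightarrow> 'a \<Rightarrow> real" and u x :: real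
  assumes "standard_brownian_motion M W"
    and "u \<in> {0<..1}"
    and "x \<in> {0..<pi / 2}"
  shows "measure M {\<omega> \<in> space M. angle (Z W u \<omega>) e1 \<le> x} = 2 / pi * arctan (sqrt (tan x))"
proof -
  interpret standard_brownian_motion M W by fact
  define T where "T = 3 * u / 7"
  have T: "0 < T" using assms(2) by (simp add: T_def)
  have "0 \<le> tan x" using assms(3) by (cases "x = 0") (auto intro!: less_imp_le tan_gt_zero)
  have "angle (Z W u \<omega>) e1 \<le> x \<longleftrightarrow> 1 / (1 + tan x) \<le> occupation T \<omega> / T" if "\<omega> \<in> space M" for \<omega>
    using that assms(2,3) T Z_eq_occupation[OF that, of u] occupation_bounds[OF that, of T] angle_e1_le_iff[of "occupation T \<omega>" T x]
    by (simp add: T_def)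
  then have "{\<omega> \<in> space M. angle (Z W u \<omega>) e1 \<le> x} = (\<lambda>\<omega>. occupation T \<omega> / T) -` {1 / (1 + tan x)..} \<inter> space M"
    by auto
  then have "measure M {\<omega> \<in> space M. angle (Z W u \<omega>) e1 \<le> x} = measure (distr M borel (\<lambda>\<omega>. occupation T \<omega> / T)) {1 / (1 + tan x)..}"
    by (simp add: measure_distr)
  also have "\<dots> = 2 / pi * arctan (sqrt (tan x))"
    unfolding levy_arcsine_law[OF T] by (rule measure_arcsine_law_atLeast) fact
  finally show ?thesis .
qed

end
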